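(* For every integer $k\geq 1$ there is a graph $G$ such that for every chordal partition $\mathcal{P}$ of $G$, some part of $\mathcal{P}$ contains $K_k$. Moreover, for every integer $t\geq 4$ there is a graph $G$ with tree-width at most $t-1$ (and thus with no $K_{t+1}$-minor) such that for every chordal partition $\mathcal{P}$ of $G$, some part of $\mathcal{P}$ contains a complete graph on at least $\lfloor (3t-11)^{1/3}\rfloor$ vertices.
   Context: All graphs are finite, simple and undirected. A graph $G$ contains a graph $H$ if $H$ is isomorphic to an induced subgraph of $G$. A partition of a graph $G$ is a set $\mathcal{P}$ of non-empty induced subgraphs of $G$ such that each vertex of $G$ is in exactly one element of $\mathcal{P}$; each element of $\mathcal{P}$ is called a part. The quotient $G/\mathcal{P}$ is the graph with vertex set $\mathcal{P}$ in which distinct parts $P,Q\in\mathcal{P}$ are adjacent if and only if some vertex in $P$ is adjacent in $G$ to some vertex in $Q$. A partition is connected if each part is a connected graph. A partition is chordal if it is connected and its quotient is chordal, that is, the quotient contains no induced cycle of length at least four. $K_n$ denotes the complete graph on $n$ vertices. *)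

theory Defs
  imports Complex_Main "Graph_Theory.Graph_Theory"
begin

text \<open>
  A finite simple undirected graph is a \<^locale>\<open>pair_graph\<close>: a finite, loop-free, symmetric
  digraph whose arcs are pairs of vertices, so that an edge uv is present as both (u,v) and (v,u).
  Subgraphs, induced subgraphs, isomorphism and connectedness are those of the library, which
  speaks about pair graphs through the coercion \<^const>\<open>with_proj\<close>. Note that
  \<^const>\<open>connected\<close> includes non-emptiness.
\<close>

definition contains :: "'a pair_pre_digraph \<Rightarrow> 'b pair_pre_digraph \<Rightarrow> bool" where
  "contains G H \<longleftrightarrow>
     (\<exists>S :: 'a pair_pre_digraph. induced_subgraph (with_proj S) (with_proj G) \<and>
        digraph_iso (with_proj H) (with_proj S))"

definition complete_graph :: "nat \<Rightarrow> nat pair_pre_digraph" where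
  "complete_graph n = \<lparr> pverts = {..<n}, parcs = {(u, v). u < n \<and> v < n \<and> u \<noteq> v} \<rparr>"

text \<open>This is the n-vertex cycle only for n \<open>\<ge>\<close> 3.\<close>

definition cycle_graph :: "nat \<Rightarrow> nat pair_pre_digraph" where
  "cycle_graph n = \<lparr> pverts = {..<n},
     parcs = {(u, v). u < n \<and> v < n \<and> (v = Suc u mod n \<or> u = Suc v mod n)} \<rparr>"

definition chordal :: "'a pair_pre_digraph \<Rightarrow> bool" where
  "chordal G \<longleftrightarrow> (\<forall>n\<ge>4. \<not> contains G (cycle_graph n))"


definition graph_partition :: "'a pair_pre_digraph \<Rightarrow> 'a pair_pre_digraph set \<Rightarrow> bool" where
  "graph_partition G \<P> \<longleftrightarrow>
     (\<forall>P\<in>\<P>. induced_subgraph (with_proj P) (with_proj G) \<and> pverts P \<noteq> {}) \<and>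
     (\<forall>v\<in>pverts G. \<exists>!P. P \<in> \<P> \<and> v \<in> pverts P)"

definition quotient_graph ::
  "'a pair_pre_digraph \<Rightarrow> 'a pair_pre_digraph set \<Rightarrow> 'a pair_pre_digraph pair_pre_digraph" where
  "quotient_graph G \<P> = \<lparr> pverts = \<P>,
     parcs = {(P, Q). P \<in> \<P> \<and> Q \<in> \<P> \<and> P \<noteq> Q \<and>
                (\<exists>u\<in>pverts P. \<exists>v\<in>pverts Q. (u, v) \<in> parcs G)} \<rparr>"

definition connected_partition :: "'a pair_pre_digraph \<Rightarrow> 'a pair_pre_digraph set \<Rightarrow> bool" where
  "connected_partition G \<P> \<longleftrightarrow> graph_partition G \<P> \<and> (\<forall>P\<in>\<P>. connected (with_proj P))"

definition chordal_partition :: "'a pair_pre_digraph \<Rightarrow> 'a pair_pre_digraph set \<Rightarrow> bool" where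
  "chordal_partition G \<P> \<longleftrightarrow> connected_partition G \<P> \<and> chordal (quotient_graph G \<P>)"


text \<open>
  The library's \<^const>\<open>tree\<close> is unsuitable here: in a symmetric digraph, going forth and back along
  an edge is a directed cycle of length 2. Cycles of the undirected graph are those of length at
  least 3.
\<close>

definition undirected_tree :: "'a pair_pre_digraph \<Rightarrow> bool" where
  "undirected_tree T \<longleftrightarrow>
     pair_graph T \<and> connected (with_proj T) \<and>
     \<not> (\<exists>p. pre_digraph.cycle (with_proj T) p \<and> 3 \<le> length p)"

definition tree_decomposition ::
  "'a pair_pre_digraph \<Rightarrow> 'i pair_pre_digraph \<Rightarrow> ('i \<Rightarrow> 'a set) \<Rightarrow> bool" where
  "tree_decomposition G T B \<longleftrightarrow>
     undirected_tree T \<and>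
     (\<forall>i\<in>pverts T. B i \<subseteq> pverts G) \<and>
     (\<forall>(u, v)\<in>parcs G. \<exists>i\<in>pverts T. u \<in> B i \<and> v \<in> B i) \<and>
     (\<forall>v\<in>pverts G. connected (with_proj T \<restriction> {i \<in> pverts T. v \<in> B i}))"

definition decomposition_width :: "'i pair_pre_digraph \<Rightarrow> ('i \<Rightarrow> 'a set) \<Rightarrow> nat" where
  "decomposition_width T B = Max ((\<lambda>i. card (B i)) ` pverts T) - 1"

text \<open>
  Every finite tree has a copy on natural numbers, so it suffices to index bags by these.
  The graph without vertices gets tree-width 0 rather than -1.
\<close>

definition treewidth :: "'a pair_pre_digraph \<Rightarrow> nat" where
  "treewidth G = (LEAST w. \<exists>(T :: nat pair_pre_digraph) B.
     tree_decomposition G T B \<and> decomposition_width T B = w)"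


text \<open>Minors are given by branch sets.\<close>

definition has_minor :: "'a pair_pre_digraph \<Rightarrow> 'b pair_pre_digraph \<Rightarrow> bool" where
  "has_minor G H \<longleftrightarrow> (\<exists>\<phi>.
     (\<forall>x\<in>pverts H. \<phi> x \<subseteq> pverts G \<and> connected (with_proj G \<restriction> \<phi> x)) \<and>
     (\<forall>x\<in>pverts H. \<forall>y\<in>pverts H. x \<noteq> y \<longrightarrow> \<phi> x \<inter> \<phi> y = {}) \<and>
     (\<forall>(x, y)\<in>parcs H. \<exists>u\<in>\<phi> x. \<exists>v\<in>\<phi> y. (u, v) \<in> parcs G))"

end

theory Submission
  imports Defs
begin

text \<open>
  A partition is treated as a labelling of the vertices, two vertices having the same label iff they
  lie in the same part. Of chordality only the absence of an induced four-cycle in the quotient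
  matters, which gives the property \<open>connected_C4_free\<close>.

  This property passes to both sides of a clique-sum: if two graphs are glued along a common clique,
  then a part can leave one of them only through that clique, and two parts that touch outside one of
  them but both meet it contain vertices of the clique, hence touch there already
  (\<open>connected_C4_free_clique_sum\<close>). It is therefore possible to glue a separate gadget onto every
  candidate clique of a graph and to argue about each gadget in isolation.

  A monochromatic \<open>k\<close>-clique is forced by induction on \<open>k\<close>, through an intermediate structure: a clique
  that is the union of \<open>r\<close> blocks, each of \<open>k\<close> equally labelled vertices, with different labels on
  different blocks.

   \<^item> From \<open>r\<close> to \<open>r + 1\<close> blocks: onto each such clique glue a graph forcing a monochromatic
     \<open>k\<close>-clique, joined completely to the clique. A vertex of the new graph that repeats one of the
     old labels completes a monochromatic \<open>(k + 1)\<close>-clique. Otherwise the new graph is partitioned on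
     its own and contributes another block (\<open>unavoidable_Suc_blocks\<close>).
   \<^item> From \<open>k + 1\<close> blocks of size \<open>k\<close> to a monochromatic \<open>(k + 1)\<close>-clique: glue on a clique of \<open>k + 1\<close>
     new vertices, one for each block, adjacent to exactly that block. If no vertex shares the label
     of its block, then the new vertices have labels that do not occur on the blocks. If these are all
     equal, the new clique is monochromatic; otherwise two of them together with the labels of the
     corresponding blocks form an induced four-cycle (\<open>unavoidable_mono_Suc\<close>).

  If \<open>w\<close> bounds the tree-width of the graph for \<open>k\<close>, the one for \<open>k + 1\<close> has tree-width at most the
  maximum of \<open>w + k\<^sup>2\<close> and \<open>k\<^sup>2 + 2 * k\<close>, which solves to about \<open>k\<^sup>3 / 3\<close>
  (\<open>unavoidable_has_mono_clique\<close>).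

  All graphs here are subgraphs of graphs built by attaching vertices, one at a time, to cliques of at
  most \<open>w\<close> vertices. For these the tree decomposition and the absence of a complete minor on \<open>w + 2\<close>
  vertices are direct inductions over the construction (\<open>clique_built_bags\<close>, \<open>clique_built_minor\<close>).
\<close>

section \<open>Graphs built by attaching vertices to cliques\<close>

definition clique :: "'a rel \<Rightarrow> 'a set \<Rightarrow> bool" where
  "clique E S \<longleftrightarrow> (\<forall>x\<in>S. \<forall>y\<in>S. x \<noteq> y \<longrightarrow> (x, y) \<in> E)"

lemma cliqueD: "clique E S \<Longrightarrow> x \<in> S \<Longrightarrow> y \<in> S \<Longrightarrow> x \<noteq> y \<Longrightarrow> (x, y) \<in> E"
  by (auto simp: clique_def)

lemma clique_mono: "clique E S \<Longrightarrow> E \<subseteq> E' \<Longrightarrow> T \<subseteq> S \<Longrightarrow> clique E' T"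
  unfolding clique_def by blast

text \<open>
  These are the chordal graphs with cliques of at most \<open>w + 1\<close> vertices, given by reversing a perfect
  elimination ordering; their subgraphs are the graphs of tree-width at most \<open>w\<close>. Unlike a tree
  decomposition, the construction is easy to extend and to induct on.
\<close>

inductive clique_built :: "nat \<Rightarrow> 'a set \<Rightarrow> 'a rel \<Rightarrow> bool" for w where
  empty: "clique_built w {} {}"
| add: "clique_built w V F \<Longrightarrow> v \<notin> V \<Longrightarrow> N \<subseteq> V \<Longrightarrow> clique F N \<Longrightarrow> card N \<le> w \<Longrightarrow>
    clique_built w (insert v V) (F \<union> {v} \<times> N \<union> N \<times> {v})"

lemma clique_built_finite: "clique_built w V F \<Longrightarrow> finite V"
  by (induction rule: clique_built.induct) auto

lemma clique_built_subset: "clique_built w V F \<Longrightarrow> F \<subseteq> V \<times> V"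
  by (induction rule: clique_built.induct) auto

lemma clique_built_sym: "clique_built w V F \<Longrightarrow> sym F"
  by (induction rule: clique_built.induct) (auto simp: sym_def)

lemma clique_built_mono: "clique_built w V F \<Longrightarrow> w \<le> w' \<Longrightarrow> clique_built w' V F"
  by (induction rule: clique_built.induct) (auto intro!: clique_built.intros)

lemma clique_built_complete:
  "finite W \<Longrightarrow> card W \<le> Suc k \<Longrightarrow> clique_built k W (W \<times> W - Id)"
proof (induction W rule: finite_induct)
  case empty
  then show ?case by (simp add: clique_built.empty)
next
  case (insert v W)
  then have "clique_built k (insert v W) ((W \<times> W - Id) \<union> {v} \<times> W \<union> W \<times> {v})"
    by (intro clique_built.add) (auto simp: clique_def)
  moreover have "(W \<times> W - Id) \<union> {v} \<times> W \<union> W \<times> {v} = insert v W \<times> insert v W - Id"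
    using insert.hyps by auto
  ultimately show ?case by simp
qed

text \<open>
  The vertices of \<open>W\<close> are added in their own order, each one attached also to all of \<open>C\<close>; this is where
  the widths add up.
\<close>

lemma clique_built_join:
  assumes "clique_built w0 W F0" "clique_built w V F" "clique F C" "C \<subseteq> V"
    and "W \<inter> V = {}" "w0 + card C \<le> w"
  shows "clique_built w (V \<union> W) (F \<union> F0 \<union> C \<times> W \<union> W \<times> C)"
  using assms
proof (induction rule: clique_built.induct)
  case empty
  then show ?case by simp
next
  case (add W F0 v N)
  let ?F = "F \<union> F0 \<union> C \<times> W \<union> W \<times> C"
  have fin: "finite V" "finite W"
    using add.hyps(1) add.prems(1) by (auto dest: clique_built_finite)
  have "clique_built w (insert v (V \<union> W)) (?F \<union> {v} \<times> (N \<union> C) \<union> (N \<union> C) \<times> {v})"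
  proof (rule clique_built.add)
    show "clique_built w (V \<union> W) ?F"
      using add by auto
    show "v \<notin> V \<union> W" "N \<union> C \<subseteq> V \<union> W"
      using add by auto
    show "clique ?F (N \<union> C)"
      using add.hyps(3,4) add.prems(2) unfolding clique_def by blast
    have "card (N \<union> C) \<le> card N + card C"
      by (rule card_Un_le)
    then show "card (N \<union> C) \<le> w"
      using add.hyps(5) add.prems(5) by linarith
  qed
  moreover have "?F \<union> {v} \<times> (N \<union> C) \<union> (N \<union> C) \<times> {v}
      = F \<union> (F0 \<union> {v} \<times> N \<union> N \<times> {v}) \<union> C \<times> insert v W \<union> insert v W \<times> C"
    by auto
  ultimately show ?case by simp
qed

text \<open>
  Known as partial \<open>w\<close>-trees. Loops and one-way edges are excluded, so that \<open>(V, E)\<close> is a simple graph.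
\<close>

definition partial_tree :: "nat \<Rightarrow> 'a set \<Rightarrow> 'a rel \<Rightarrow> bool" where
  "partial_tree w V E \<longleftrightarrow>
     E \<subseteq> V \<times> V \<and> sym E \<and> irrefl E \<and> (\<exists>F. clique_built w V F \<and> E \<subseteq> F)"

lemma partial_tree_attach:
  assumes V: "partial_tree w V E" and C: "clique E C" "C \<subseteq> V"
    and W: "partial_tree w0 W E0" "W \<inter> V = {}" and w: "w0 + card C \<le> w"
    and X: "X \<subseteq> C \<times> W"
  shows "partial_tree w (V \<union> W) (E \<union> E0 \<union> X \<union> X\<inverse>)"
proof -
  obtain F F0 where F: "clique_built w V F" "E \<subseteq> F" and F0: "clique_built w0 W F0" "E0 \<subseteq> F0"
    using V W(1) unfolding partial_tree_def by blast
  have "clique_built w (V \<union> W) (F \<union> F0 \<union> C \<times> W \<union> W \<times> C)"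
    using F0(1) F(1) clique_mono[OF C(1) F(2)] C(2) W(2) w by (intro clique_built_join) auto
  moreover have "E \<union> E0 \<union> X \<union> X\<inverse> \<subseteq> F \<union> F0 \<union> C \<times> W \<union> W \<times> C"
    using F F0 X by auto
  moreover have "E \<union> E0 \<union> X \<union> X\<inverse> \<subseteq> (V \<union> W) \<times> (V \<union> W)"
    using V W X C(2) unfolding partial_tree_def by auto
  moreover have "sym (E \<union> E0 \<union> X \<union> X\<inverse>)"
    using V W(1) unfolding partial_tree_def sym_def by blast
  moreover have "irrefl (E \<union> E0 \<union> X \<union> X\<inverse>)"
    using V W X C(2) unfolding partial_tree_def irrefl_def by blast
  ultimately show ?thesis
    unfolding partial_tree_def by blast
qed

section \<open>Labellings with connected classes and no induced four-cycle of classes\<close>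

text \<open>
  Adjacency in the quotient; equal labels are not excluded.
\<close>

definition touching :: "('a \<Rightarrow> 'b) \<Rightarrow> 'a rel \<Rightarrow> 'b \<Rightarrow> 'b \<Rightarrow> bool" where
  "touching f E a b \<longleftrightarrow> (\<exists>u v. (u, v) \<in> E \<and> f u = a \<and> f v = b)"

lemma touchingI: "(u, v) \<in> E \<Longrightarrow> touching f E (f u) (f v)"
  unfolding touching_def by metis

definition induced_C4 :: "('a \<Rightarrow> 'b) \<Rightarrow> 'a rel \<Rightarrow> 'b \<Rightarrow> 'b \<Rightarrow> 'b \<Rightarrow> 'b \<Rightarrow> bool" where
  "induced_C4 f E a b c d \<longleftrightarrow> distinct [a, b, c, d] \<and>
     touching f E a b \<and> touching f E b c \<and> touching f E c d \<and> touching f E d a \<and>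
     \<not> touching f E a c \<and> \<not> touching f E b d"

text \<open>
  A walk along these edges never leaves the part in which it starts, so reachability by them is
  connectedness of the parts.
\<close>

definition inner_edges :: "('a \<Rightarrow> 'b) \<Rightarrow> 'a rel \<Rightarrow> 'a rel" where
  "inner_edges f E = {(u, v) \<in> E. f u = f v}"

definition connected_C4_free :: "('a \<Rightarrow> 'b) \<Rightarrow> 'a set \<Rightarrow> 'a rel \<Rightarrow> bool" where
  "connected_C4_free f V E \<longleftrightarrow>
     (\<forall>x\<in>V. \<forall>y\<in>V. f x = f y \<longrightarrow> (x, y) \<in> (inner_edges f E)\<^sup>*) \<and>
     (\<forall>a b c d. \<not> induced_C4 f E a b c d)"

lemma inner_edges_rtrancl_label: "(x, y) \<in> (inner_edges f E)\<^sup>* \<Longrightarrow> f x = f y"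
  by (induction rule: rtrancl_induct) (auto simp: inner_edges_def)

text \<open>
  A walk inside a part that leaves \<open>V1\<close> does so through the common clique and comes back through it; as
  two equally labelled vertices of the clique are adjacent, the detour can be cut short within \<open>V1\<close>.
  For the same reason a label of \<open>V1\<close> that also occurs in \<open>V2\<close> occurs in the clique, so that two such
  labels that touch in \<open>V2\<close> touch in the clique already. Thus the four-cycles of the restricted
  labelling are induced in the whole graph.
\<close>

lemma connected_C4_free_clique_sum:
  assumes good: "connected_C4_free f (V1 \<union> V2) (E1 \<union> E2)"
    and E1: "E1 \<subseteq> V1 \<times> V1" and E2: "E2 \<subseteq> V2 \<times> V2"
    and clq: "clique E1 (V1 \<inter> V2)"
  shows "connected_C4_free f V1 E1"
proof -
  have path: "(y \<in> V1 \<longrightarrow> (x, y) \<in> (inner_edges f E1)\<^sup>*) \<and>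
      (y \<notin> V1 \<longrightarrow> (\<exists>c \<in> V1 \<inter> V2. (x, c) \<in> (inner_edges f E1)\<^sup>*))"
    if "(x, y) \<in> (inner_edges f (E1 \<union> E2))\<^sup>*" "x \<in> V1" for x y
    using that(1)
  proof (induction rule: rtrancl_induct)
    case base
    then show ?case using that(2) by simp
  next
    case (step y z)
    have yz: "(y, z) \<in> E1 \<or> (y, z) \<in> E2" "f y = f z"
      using step.hyps(2) by (auto simp: inner_edges_def)
    show ?case
    proof (cases "(y, z) \<in> E1")
      case True
      then have "y \<in> V1" "z \<in> V1" "(y, z) \<in> inner_edges f E1"
        using E1 yz by (auto simp: inner_edges_def)
      then show ?thesis
        using step.IH by (meson rtrancl.rtrancl_into_rtrancl)
    next
      case False
      then have "y \<in> V2" "z \<in> V2" using yz E2 by auto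
      \<comment> \<open>The walk is at, or last left \<open>V1\<close> through, a vertex of the common clique.\<close>
      then obtain c where c: "c \<in> V1 \<inter> V2" "(x, c) \<in> (inner_edges f E1)\<^sup>*"
        using step.IH by blast
      have "(x, z) \<in> (inner_edges f (E1 \<union> E2))\<^sup>*"
        using step.hyps by (rule rtrancl.rtrancl_into_rtrancl)
      then have fc: "f c = f z"
        using c(2) by (metis inner_edges_rtrancl_label)
      have "(x, z) \<in> (inner_edges f E1)\<^sup>*" if "z \<in> V1"
      proof (cases "c = z")
        case False
        then have "(c, z) \<in> inner_edges f E1"
          using cliqueD[OF clq c(1), of z] that \<open>z \<in> V2\<close> fc by (simp add: inner_edges_def)
        then show ?thesis using c(2) by (rule rtrancl.rtrancl_into_rtrancl[rotated])
      qed (use c in simp)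
      then show ?thesis using c by blast
    qed
  qed
  have conn: "(x, y) \<in> (inner_edges f (E1 \<union> E2))\<^sup>*" if "x \<in> V1 \<union> V2" "y \<in> V1 \<union> V2" "f x = f y" for x y
    using good that unfolding connected_C4_free_def by blast
  have rep: "\<exists>c \<in> V1 \<inter> V2. f c = f u" if xu: "x \<in> V1" "u \<in> V2" "f x = f u" for x u
  proof (cases "u \<in> V1")
    case True
    then show ?thesis using that by blast
  next
    case False
    then obtain c where "c \<in> V1 \<inter> V2" "(x, c) \<in> (inner_edges f E1)\<^sup>*"
      using path[of x u] conn[of x u] xu by blast
    then show ?thesis using that(3) by (metis inner_edges_rtrancl_label)
  qed
  have touch: "touching f E1 a b"
    if ab: "touching f (E1 \<union> E2) a b" "a \<in> f ` V1" "b \<in> f ` V1" "a \<noteq> b" for a b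
  proof -
    obtain u v where uv: "(u, v) \<in> E1 \<union> E2" "f u = a" "f v = b"
      using ab(1) unfolding touching_def by blast
    show ?thesis
    proof (cases "(u, v) \<in> E1")
      case True
      then show ?thesis using uv unfolding touching_def by blast
    next
      case False
      then have "u \<in> V2" "v \<in> V2" using uv E2 by auto
      then obtain c c' where "c \<in> V1 \<inter> V2" "f c = a" "c' \<in> V1 \<inter> V2" "f c' = b"
        using rep ab uv by (metis imageE)
      then show ?thesis
        using cliqueD[OF clq, of c c'] ab(4) unfolding touching_def by blast
    qed
  qed
  have "\<not> induced_C4 f E1 a b c d" for a b c d
  proof
    assume C4: "induced_C4 f E1 a b c d"
    have mono: "touching f E1 p q \<Longrightarrow> touching f (E1 \<union> E2) p q" for p q
      unfolding touching_def by blast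
    have img: "touching f E1 p q \<Longrightarrow> p \<in> f ` V1" for p q
      using E1 unfolding touching_def by blast
    have "a \<in> f ` V1" "b \<in> f ` V1" "c \<in> f ` V1" "d \<in> f ` V1"
      using C4 img unfolding induced_C4_def by blast+
    then have "induced_C4 f (E1 \<union> E2) a b c d"
      using C4 mono touch unfolding induced_C4_def by auto
    then show False using good unfolding connected_C4_free_def by blast
  qed
  moreover have "(x, y) \<in> (inner_edges f E1)\<^sup>*" if "x \<in> V1" "y \<in> V1" "f x = f y" for x y
    using path[of x y] conn[of x y] that by blast
  ultimately show ?thesis unfolding connected_C4_free_def by blast
qed

text \<open>
  The graph is the clique-sum along \<open>C\<close> of the old graph and of the gadget on \<open>C \<union> W\<close>.
\<close>

lemma connected_C4_free_attach:
  assumes good: "connected_C4_free f (V \<union> W) (E \<union> E0 \<union> X \<union> X\<inverse>)"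
    and sub: "E \<subseteq> V \<times> V" "E0 \<subseteq> W \<times> W" "X \<subseteq> C \<times> W" "C \<subseteq> V"
    and clq: "clique E C" and disj: "W \<inter> V = {}"
  shows "connected_C4_free f V E" "connected_C4_free f (C \<union> W) (Restr E C \<union> E0 \<union> X \<union> X\<inverse>)"
proof -
  let ?E2 = "Restr E C \<union> E0 \<union> X \<union> X\<inverse>"
  have eqV: "V \<union> W = V \<union> (C \<union> W)" and eqE: "E \<union> E0 \<union> X \<union> X\<inverse> = E \<union> ?E2"
    using sub by auto
  have int: "V \<inter> (C \<union> W) = C" using sub disj by auto
  have sub2: "?E2 \<subseteq> (C \<union> W) \<times> (C \<union> W)" using sub by auto
  have g: "connected_C4_free f (V \<union> (C \<union> W)) (E \<union> ?E2)"
    using good by (simp only: eqV[symmetric] eqE[symmetric])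
  show "connected_C4_free f V E"
    using g sub(1) sub2 by (rule connected_C4_free_clique_sum) (simp add: int clq)
  have g': "connected_C4_free f ((C \<union> W) \<union> V) (?E2 \<union> E)"
    using g by (simp only: Un_commute)
  have "clique ?E2 C" using clq unfolding clique_def by auto
  then show "connected_C4_free f (C \<union> W) ?E2"
    using g' by (intro connected_C4_free_clique_sum[OF _ sub2 sub(1)]) (simp_all add: int Int_commute)
qed

text \<open>
  Classes that avoid \<open>C\<close> cannot connect through \<open>C\<close>, and they touch only by edges of \<open>W\<close>.
\<close>

lemma connected_C4_free_new_labels:
  assumes good: "connected_C4_free f (C \<union> W) (R \<union> E0 \<union> X \<union> X\<inverse>)" and "R \<subseteq> C \<times> C"
    and "E0 \<subseteq> W \<times> W" "X \<subseteq> C \<times> W" and new: "f ` W \<inter> f ` C = {}"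
  shows "connected_C4_free f W E0"
proof -
  let ?E = "R \<union> E0 \<union> X \<union> X\<inverse>"
  have path: "y \<in> W \<and> (x, y) \<in> (inner_edges f E0)\<^sup>*" if "(x, y) \<in> (inner_edges f ?E)\<^sup>*" "x \<in> W" for x y
    using that(1)
  proof (induction rule: rtrancl_induct)
    case base
    then show ?case using that by simp
  next
    case (step y z)
    have "f y = f z" "(y, z) \<in> ?E" using step.hyps(2) by (auto simp: inner_edges_def)
    have "f y \<in> f ` W" using step.IH by blast
    then have "f y \<notin> f ` C" "f z \<notin> f ` C" using new \<open>f y = f z\<close> by auto
    then have "y \<notin> C" "z \<notin> C" by blast+
    then have "(y, z) \<in> E0" using \<open>(y, z) \<in> ?E\<close> assms(2-4) by blast
    then show ?case using step assms(3) \<open>f y = f z\<close>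
      by (auto simp: inner_edges_def intro: rtrancl.rtrancl_into_rtrancl)
  qed
  have touch: "touching f E0 a b" if ab: "touching f ?E a b" "a \<in> f ` W" "b \<in> f ` W" for a b
  proof -
    obtain u v where uv: "(u, v) \<in> ?E" "f u = a" "f v = b"
      using ab(1) unfolding touching_def by blast
    then have "f u \<notin> f ` C" "f v \<notin> f ` C" using ab new by blast+
    then have "u \<notin> C" "v \<notin> C" by blast+
    then have "(u, v) \<in> E0" using uv(1) assms(2-4) by blast
    then show ?thesis using uv unfolding touching_def by blast
  qed
  have "\<not> induced_C4 f E0 a b c d" for a b c d
  proof
    assume C4: "induced_C4 f E0 a b c d"
    have mono: "touching f E0 p q \<Longrightarrow> touching f ?E p q" for p q
      unfolding touching_def by blast
    have img: "touching f E0 p q \<Longrightarrow> p \<in> f ` W" for p q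
      using assms(3) unfolding touching_def by blast
    have "a \<in> f ` W" "b \<in> f ` W" "c \<in> f ` W" "d \<in> f ` W"
      using C4 img unfolding induced_C4_def by blast+
    then have "induced_C4 f ?E a b c d"
      using C4 mono touch unfolding induced_C4_def by blast
    then show False using good unfolding connected_C4_free_def by blast
  qed
  moreover have "(x, y) \<in> (inner_edges f E0)\<^sup>*" if "x \<in> W" "y \<in> W" "f x = f y" for x y
    using path that good unfolding connected_C4_free_def by blast
  ultimately show ?thesis unfolding connected_C4_free_def by blast
qed

section \<open>Extensions whose labellings restrict to the smaller graph\<close>

text \<open>
  The last conjunct is what makes it safe to go on gluing: whatever has been shown about labellings of
  the smaller graph remains available. The set \<open>Z\<close> collects vertices reserved for other graphs, which
  avoids renaming vertices when graphs are put together.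
\<close>

definition extends :: "nat \<Rightarrow> 'a set \<Rightarrow> 'a set \<Rightarrow> 'a rel \<Rightarrow> 'a set \<Rightarrow> 'a rel \<Rightarrow> bool" where
  "extends w Z V E V' E' \<longleftrightarrow> V \<subseteq> V' \<and> E \<subseteq> E' \<and> V' \<inter> Z = {} \<and> partial_tree w V' E' \<and>
     (\<forall>f :: 'a \<Rightarrow> 'a set. connected_C4_free f V' E' \<longrightarrow> connected_C4_free f V E)"

lemma extends_refl: "partial_tree w V E \<Longrightarrow> V \<inter> Z = {} \<Longrightarrow> extends w Z V E V E"
  by (simp add: extends_def)

lemma extends_trans:
  "extends w Z V E V' E' \<Longrightarrow> extends w Z V' E' V'' E'' \<Longrightarrow> extends w Z V E V'' E''"
  unfolding extends_def by (meson order_trans)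

lemma extends_attach:
  assumes "partial_tree w V E" "clique E C" "C \<subseteq> V" "partial_tree w0 W E0"
    and "W \<inter> V = {}" "w0 + card C \<le> w" "X \<subseteq> C \<times> W" "V \<inter> Z = {}" "W \<inter> Z = {}"
  shows "extends w Z V E (V \<union> W) (E \<union> E0 \<union> X \<union> X\<inverse>)"
proof -
  have "E \<subseteq> V \<times> V" "E0 \<subseteq> W \<times> W"
    using assms(1,4) unfolding partial_tree_def by blast+
  then have "connected_C4_free f V E" if "connected_C4_free f (V \<union> W) (E \<union> E0 \<union> X \<union> X\<inverse>)" for f :: "'a \<Rightarrow> 'a set"
    using connected_C4_free_attach(1)[OF that] assms by blast
  then show ?thesis
    using partial_tree_attach[OF assms(1-7)] assms(8,9) unfolding extends_def by blast
qed

text \<open>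
  Handles one task \<open>i\<close> after the other. A task may be met by an extension that is not known in advance,
  so \<open>step\<close> has to cope with every extension reached so far.
\<close>

lemma extends_all:
  assumes "finite I" "partial_tree w V E" "V \<inter> Z = {}"
    and step: "\<And>i V' E'. i \<in> I \<Longrightarrow> extends w Z V E V' E' \<Longrightarrow>
      \<exists>V'' E''. extends w Z V' E' V'' E'' \<and> Q i V'' E''"
    and mono: "\<And>i V' E' V'' E''. Q i V' E' \<Longrightarrow> extends w Z V' E' V'' E'' \<Longrightarrow> Q i V'' E''"
  shows "\<exists>V' E'. extends w Z V E V' E' \<and> (\<forall>i\<in>I. Q i V' E')"
  using assms(1) step
proof (induction I rule: finite_induct)
  case empty
  then show ?case using extends_refl[OF assms(2,3)] by blast
next
  case (insert i I)
  then obtain V' E' where 1: "extends w Z V E V' E'" "\<forall>i\<in>I. Q i V' E'"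
    by (metis insertCI)
  obtain V'' E'' where 2: "extends w Z V' E' V'' E''" "Q i V'' E''"
    using insert.prems[OF _ 1(1)] by blast
  show ?case using 1 2 extends_trans mono by (metis insert_iff)
qed

section \<open>Forcing monochromatic cliques\<close>

definition monochromatic :: "('a \<Rightarrow> 'b) \<Rightarrow> 'a set \<Rightarrow> bool" where
  "monochromatic f D \<longleftrightarrow> (\<forall>x\<in>D. \<forall>y\<in>D. f x = f y)"

lemma monochromaticD: "monochromatic f D \<Longrightarrow> x \<in> D \<Longrightarrow> y \<in> D \<Longrightarrow> f x = f y"
  unfolding monochromatic_def by (drule (1) bspec)+

definition has_mono_clique :: "nat \<Rightarrow> ('a \<Rightarrow> 'b) \<Rightarrow> 'a set \<Rightarrow> 'a rel \<Rightarrow> bool" where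
  "has_mono_clique k f V E \<longleftrightarrow>
     (\<exists>D\<subseteq>V. card D = k \<and> clique E D \<and> monochromatic f D)"

text \<open>
  The sets in \<open>\<D>\<close> are the blocks. The last conjunct also makes them disjoint.
\<close>

definition block_family :: "nat \<Rightarrow> nat \<Rightarrow> ('a \<Rightarrow> 'b) \<Rightarrow> 'a set \<Rightarrow> 'a rel \<Rightarrow> 'a set set \<Rightarrow> bool" where
  "block_family k r f V E \<D> \<longleftrightarrow> finite \<D> \<and> card \<D> = r \<and> \<Union>\<D> \<subseteq> V \<and> clique E (\<Union>\<D>) \<and>
     (\<forall>D\<in>\<D>. card D = k \<and> monochromatic f D) \<and>
     (\<forall>D\<in>\<D>. \<forall>D'\<in>\<D>. D \<noteq> D' \<longrightarrow> (\<forall>x\<in>D. \<forall>y\<in>D'. f x \<noteq> f y))"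

lemma has_mono_clique_supergraph:
  assumes "has_mono_clique k f V E" "V \<subseteq> V'" "E \<subseteq> E'"
  shows "has_mono_clique k f V' E'"
proof -
  obtain D where "D \<subseteq> V" "card D = k" "clique E D" "monochromatic f D"
    using assms(1) unfolding has_mono_clique_def by blast
  then show ?thesis
    unfolding has_mono_clique_def using assms(2,3) clique_mono[of E D E' D]
    by (intro exI[of _ D]) auto
qed

lemma block_family_supergraph: "block_family k r f V E \<D> \<Longrightarrow> V \<subseteq> V' \<Longrightarrow> E \<subseteq> E' \<Longrightarrow> block_family k r f V' E' \<D>"
  unfolding block_family_def using clique_mono[of E "\<Union>\<D>" E' "\<Union>\<D>"] by (simp add: order_trans[of _ V V'])

lemma block_family_card: "block_family k r f V E \<D> \<Longrightarrow> card (\<Union>\<D>) \<le> k * r"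
  using card_Union_le_sum_card[of \<D>] unfolding block_family_def by (simp add: mult.commute)

text \<open>
  Requiring a graph outside every finite set \<open>Z\<close> provides fresh disjoint copies. Labels are sets of
  vertices since a part is named by the set of its vertices.
\<close>

definition unavoidable ::
  "nat \<Rightarrow> ((nat \<Rightarrow> nat set) \<Rightarrow> nat set \<Rightarrow> nat rel \<Rightarrow> bool) \<Rightarrow> bool" where
  "unavoidable w P \<longleftrightarrow> (\<forall>Z. finite Z \<longrightarrow> (\<exists>V E. V \<inter> Z = {} \<and> partial_tree w V E \<and>
     (\<forall>f. connected_C4_free f V E \<longrightarrow> P f V E)))"

lemma unavoidable_imp:
  assumes "unavoidable w P" "\<And>f V E. P f V E \<Longrightarrow> Q f V E"
  shows "unavoidable w Q"
  unfolding unavoidable_def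
proof (intro allI impI)
  fix Z :: "nat set" assume "finite Z"
  then obtain V E where VE: "V \<inter> Z = {}" "partial_tree w V E" "\<forall>f. connected_C4_free f V E \<longrightarrow> P f V E"
    by (rule assms(1)[unfolded unavoidable_def, THEN spec, THEN mp, elim_format]) (elim exE conjE)
  then show "\<exists>V E. V \<inter> Z = {} \<and> partial_tree w V E \<and> (\<forall>f. connected_C4_free f V E \<longrightarrow> Q f V E)"
    using assms(2) by (intro exI[of _ V] exI[of _ E] conjI allI impI) simp_all
qed

lemma unavoidable_width_le:
  assumes "unavoidable w P" "w \<le> w'"
  shows "unavoidable w' P"
  unfolding unavoidable_def
proof (intro allI impI)
  fix Z :: "nat set" assume "finite Z"
  then obtain V E where VE: "V \<inter> Z = {}" "partial_tree w V E" "\<forall>f. connected_C4_free f V E \<longrightarrow> P f V E"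
    by (rule assms(1)[unfolded unavoidable_def, THEN spec, THEN mp, elim_format]) (elim exE conjE)
  have "partial_tree w' V E"
    using VE(2) assms(2) clique_built_mono unfolding partial_tree_def by metis
  then show "\<exists>V E. V \<inter> Z = {} \<and> partial_tree w' V E \<and> (\<forall>f. connected_C4_free f V E \<longrightarrow> P f V E)"
    using VE(1,3) by (intro exI[of _ V] exI[of _ E] conjI)
qed

definition upward_closed :: "(('a \<Rightarrow> 'b) \<Rightarrow> 'a set \<Rightarrow> 'a rel \<Rightarrow> bool) \<Rightarrow> bool" where
  "upward_closed P \<longleftrightarrow>
     (\<forall>f V E V' E'. P f V E \<longrightarrow> V \<subseteq> V' \<longrightarrow> E \<subseteq> E' \<longrightarrow> P f V' E')"

lemma upward_closedD: "upward_closed P \<Longrightarrow> P f V E \<Longrightarrow> V \<subseteq> V' \<Longrightarrow> E \<subseteq> E' \<Longrightarrow> P f V' E'"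
  unfolding upward_closed_def by metis

lemma upward_closed_has_mono_clique: "upward_closed (has_mono_clique k)"
  unfolding upward_closed_def by (intro allI impI) (rule has_mono_clique_supergraph)

lemma upward_closed_mono_or_blocks:
  "upward_closed (\<lambda>f V E. has_mono_clique m f V E \<or> (\<exists>\<D>. block_family k r f V E \<D>))"
  unfolding upward_closed_def
  by (intro allI impI) (elim disjE exE; metis has_mono_clique_supergraph block_family_supergraph)

text \<open>
  The gadgets are glued onto all candidates \<open>\<D>\<close> in advance; there are finitely many, being sets of
  sets of vertices. For a given labelling, the gadget of a suitable \<open>\<D>\<close> then does its work. The
  assumption \<open>step\<close> concerns a single gadget, for an arbitrary graph that contains \<open>\<D>\<close>.
\<close>

lemma unavoidable_extend:
  assumes un: "unavoidable w (\<lambda>f V E. P f V E \<or> (\<exists>\<D>. block_family k r f V E \<D>))"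
    and closed: "upward_closed P'" and P: "\<And>f V E. P f V E \<Longrightarrow> P' f V E"
    and step: "\<And>Z V E \<D>. finite Z \<Longrightarrow> V \<inter> Z = {} \<Longrightarrow> partial_tree w V E \<Longrightarrow>
       finite \<D> \<Longrightarrow> card \<D> = r \<Longrightarrow> \<Union>\<D> \<subseteq> V \<Longrightarrow> clique E (\<Union>\<D>) \<Longrightarrow> card (\<Union>\<D>) \<le> k * r \<Longrightarrow>
       \<exists>V' E'. extends w Z V E V' E' \<and>
         (\<forall>f. connected_C4_free f V' E' \<longrightarrow> block_family k r f V E \<D> \<longrightarrow> P' f V' E')"
  shows "unavoidable w P'"
  unfolding unavoidable_def
proof (intro allI impI)
  fix Z :: "nat set" assume Z: "finite Z"
  obtain V E where VE: "V \<inter> Z = {}" "partial_tree w V E"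
    and forced: "connected_C4_free f V E \<Longrightarrow> P f V E \<or> (\<exists>\<D>. block_family k r f V E \<D>)" for f
    using un[unfolded unavoidable_def, rule_format, OF Z] by (elim exE conjE) (rule that, auto)
  have "finite V"
    using VE(2) clique_built_finite unfolding partial_tree_def by blast
  then have fin: "finite (Pow (Pow V))" by simp
  define Q where "Q = (\<lambda>\<D> V' E'. \<forall>f. connected_C4_free f V' E' \<longrightarrow> block_family k r f V E \<D> \<longrightarrow> P' f V' E')"
  have "\<exists>V'' E''. extends w Z V' E' V'' E'' \<and> Q \<D> V'' E''"
    if "extends w Z V E V' E'" for \<D> V' E'
  proof (cases "\<exists>f :: nat \<Rightarrow> nat set. block_family k r f V E \<D>")
    case True
    have V': "V' \<inter> Z = {}" "partial_tree w V' E'" "V \<subseteq> V'" "E \<subseteq> E'"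
      using that unfolding extends_def by blast+
    obtain f0 :: "nat \<Rightarrow> nat set" where "block_family k r f0 V E \<D>" using True by blast
    then have b: "block_family k r f0 V' E' \<D>" using V' block_family_supergraph by blast
    obtain V'' E'' where "extends w Z V' E' V'' E''"
      and new: "\<And>f. connected_C4_free f V'' E'' \<Longrightarrow> block_family k r f V' E' \<D> \<Longrightarrow> P' f V'' E''"
      using step[OF Z V'(1,2), of \<D>] b block_family_card[OF b] unfolding block_family_def by auto
    moreover have "Q \<D> V'' E''"
      unfolding Q_def using new block_family_supergraph[OF _ V'(3,4)] by blast
    ultimately show ?thesis by blast
  next
    case False
    then have "Q \<D> V' E'" unfolding Q_def by blast
    moreover have "extends w Z V' E' V' E'"
      using that extends_refl unfolding extends_def by blast
    ultimately show ?thesis by blast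
  qed
  moreover have "Q \<D> V'' E''" if "Q \<D> V' E'" "extends w Z V' E' V'' E''" for \<D> V' E' V'' E''
  proof -
    have "V' \<subseteq> V''" "E' \<subseteq> E''" "\<And>f :: nat \<Rightarrow> nat set. connected_C4_free f V'' E'' \<Longrightarrow> connected_C4_free f V' E'"
      using that(2) unfolding extends_def by blast+
    then show ?thesis using that(1) upward_closedD[OF closed] unfolding Q_def by blast
  qed
  ultimately have "\<exists>V' E'. extends w Z V E V' E' \<and> (\<forall>\<D>\<in>Pow (Pow V). Q \<D> V' E')"
    by (intro extends_all[OF fin VE(2,1)]) blast+
  then obtain V' E' where ext: "extends w Z V E V' E'" "\<And>\<D>. \<D> \<in> Pow (Pow V) \<Longrightarrow> Q \<D> V' E'"
    by blast
  have "P' f V' E'" if "connected_C4_free f V' E'" for f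
  proof -
    have "connected_C4_free f V E" using that ext(1) unfolding extends_def by blast
    then consider "P f V E" | \<D> where "block_family k r f V E \<D>" using forced by blast
    then show ?thesis
    proof cases
      case 1
      then show ?thesis
        using upward_closedD[OF closed P] ext(1) unfolding extends_def by blast
    next
      case (2 \<D>)
      then have "\<Union>\<D> \<subseteq> V" unfolding block_family_def by simp
      then have "\<D> \<in> Pow (Pow V)" by blast
      then show ?thesis using 2 ext(2) that unfolding Q_def by blast
    qed
  qed
  then show "\<exists>V E. V \<inter> Z = {} \<and> partial_tree w V E \<and> (\<forall>f. connected_C4_free f V E \<longrightarrow> P' f V E)"
    using ext(1) unfolding extends_def by blast
qed

lemma has_mono_clique_insert:
  assumes "D \<subseteq> V" "card D = k" "finite D" "clique E D" "monochromatic f D"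
    and "w \<in> V" "w \<notin> D" "\<forall>x\<in>D. (x, w) \<in> E \<and> (w, x) \<in> E" "\<forall>x\<in>D. f x = f w"
  shows "has_mono_clique (Suc k) f V E"
  unfolding has_mono_clique_def
  using assms by (intro exI[of _ "insert w D"]) (auto simp: clique_def monochromatic_def)

text \<open>
  The gadget is a fresh graph \<open>(W, E0)\<close> forcing a monochromatic \<open>k\<close>-clique, joined completely to the
  blocks. Any label repeated between the two enlarges a block to \<open>k + 1\<close> vertices; without repetition
  \<open>W\<close> is labelled on its own, and its \<open>k\<close>-clique is the additional block.
\<close>

lemma unavoidable_Suc_blocks:
  assumes mono: "unavoidable w0 (has_mono_clique k)" and k: "1 \<le> k" and w: "w0 + k * r \<le> w"
    and un: "unavoidable w (\<lambda>f V E. has_mono_clique (Suc k) f V E \<or> (\<exists>\<D>. block_family k r f V E \<D>))"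
  shows "unavoidable w (\<lambda>f V E. has_mono_clique (Suc k) f V E \<or> (\<exists>\<D>. block_family k (Suc r) f V E \<D>))"
proof (rule unavoidable_extend[OF un upward_closed_mono_or_blocks disjI1])
  fix Z V :: "nat set" and E \<D>
  assume Z: "finite Z" "V \<inter> Z = {}" and V: "partial_tree w V E"
    and \<D>: "finite \<D>" "card \<D> = r" "\<Union>\<D> \<subseteq> V" "clique E (\<Union>\<D>)" "card (\<Union>\<D>) \<le> k * r"
  let ?C = "\<Union>\<D>"
  have finV: "finite V" and subV: "E \<subseteq> V \<times> V"
    using V clique_built_finite unfolding partial_tree_def by blast+
  then have "finite (Z \<union> V)" using Z by simp
  obtain W E0 where W: "W \<inter> (Z \<union> V) = {}" "partial_tree w0 W E0"
    and forced: "connected_C4_free f W E0 \<Longrightarrow> has_mono_clique k f W E0" for f :: "nat \<Rightarrow> nat set"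
    using mono[unfolded unavoidable_def, rule_format, OF \<open>finite (Z \<union> V)\<close>]
    by (elim exE conjE) (rule that, auto)
  have subW: "E0 \<subseteq> W \<times> W" using W(2) unfolding partial_tree_def by blast
  let ?X = "?C \<times> W"
  let ?E = "E \<union> E0 \<union> ?X \<union> ?X\<inverse>"
  have ext: "extends w Z V E (V \<union> W) ?E"
    using V \<D>(3,4,5) W Z(2) w by (intro extends_attach) auto
  have main: "has_mono_clique (Suc k) f (V \<union> W) ?E \<or> (\<exists>\<D>'. block_family k (Suc r) f (V \<union> W) ?E \<D>')"
    if good: "connected_C4_free f (V \<union> W) ?E" and b: "block_family k r f V E \<D>" for f :: "nat \<Rightarrow> nat set"
  proof (cases "f ` W \<inter> f ` ?C = {}")
    case True
    have "connected_C4_free f (?C \<union> W) (Restr E ?C \<union> E0 \<union> ?X \<union> ?X\<inverse>)"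
      using connected_C4_free_attach(2)[OF good subV subW order_refl \<D>(3,4)] W(1) by blast
    then have "connected_C4_free f W E0"
      by (rule connected_C4_free_new_labels) (use True subW in auto)
    then obtain D where D: "D \<subseteq> W" "card D = k" "clique E0 D" "monochromatic f D"
      using forced unfolding has_mono_clique_def by blast
    have "D \<noteq> {}" using D(2) k by auto
    then have "D \<notin> \<D>" using D(1) \<D>(3) W(1) by blast
    moreover have "clique ?E (\<Union>(insert D \<D>))"
      using D(1,3) \<D>(4) unfolding clique_def by blast
    moreover have "\<forall>D1\<in>insert D \<D>. \<forall>D2\<in>insert D \<D>. D1 \<noteq> D2 \<longrightarrow> (\<forall>x\<in>D1. \<forall>y\<in>D2. f x \<noteq> f y)"
    proof -
      have "f x \<noteq> f y \<and> f y \<noteq> f x" if "x \<in> D" "y \<in> D2" "D2 \<in> \<D>" for x y D2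
        using True that D(1) by (metis UnionI disjoint_iff imageI subsetD)
      then show ?thesis using b unfolding block_family_def by (metis insert_iff)
    qed
    ultimately have "block_family k (Suc r) f (V \<union> W) ?E (insert D \<D>)"
      using b D(1,2,4) \<D>(1,3) unfolding block_family_def by auto
    then show ?thesis by blast
  next
    case False
    then obtain x D v where x: "x \<in> W" "D \<in> \<D>" "v \<in> D" "f x = f v" by blast
    have D: "D \<subseteq> V" "card D = k" "monochromatic f D" "clique E D"
      using b x(2) \<D>(3) clique_mono[OF \<D>(4), of E D] unfolding block_family_def by auto
    have "has_mono_clique (Suc k) f (V \<union> W) ?E"
    proof (rule has_mono_clique_insert)
      show "D \<subseteq> V \<union> W" "card D = k" "finite D" "monochromatic f D"
        using D finV finite_subset by auto
      show "clique ?E D" using D(4) by (rule clique_mono) auto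
      show "x \<in> V \<union> W" "x \<notin> D" using x D W(1) by auto
      show "\<forall>u\<in>D. (u, x) \<in> ?E \<and> (x, u) \<in> ?E" using x by auto
      show "\<forall>u\<in>D. f u = f x" using monochromaticD[OF D(3)] x by metis
    qed
    then show ?thesis by blast
  qed
  show "\<exists>V' E'. extends w Z V E V' E' \<and> (\<forall>f :: nat \<Rightarrow> nat set. connected_C4_free f V' E' \<longrightarrow> block_family k r f V E \<D> \<longrightarrow>
      has_mono_clique (Suc k) f V' E' \<or> (\<exists>\<D>'. block_family k (Suc r) f V' E' \<D>'))"
    by (intro exI[of _ "V \<union> W"] exI[of _ ?E] conjI allI impI ext main)
qed

text \<open>
  The gadget is a clique \<open>W\<close> of new vertices \<open>h D\<close>, one for each block \<open>D\<close> and adjacent to \<open>D\<close> only.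
  Suppose there is no monochromatic clique of \<open>k + 1\<close> vertices. Then \<open>h D\<close> does not share the label of
  \<open>D\<close> (\<open>own\<close>), hence no part that meets the blocks can pass to \<open>W\<close> (\<open>stay\<close>), and \<open>W\<close> has only new
  labels (\<open>new\<close>). As \<open>W\<close> is not monochromatic either, there are \<open>D\<close> and \<open>D'\<close> such that the labels of
  \<open>D\<close>, \<open>h D\<close>, \<open>h D'\<close>, \<open>D'\<close> are an induced four-cycle: the label of \<open>D\<close> touches no new label other than
  that of \<open>h D\<close> (\<open>cross\<close>).
\<close>

lemma unavoidable_mono_Suc:
  assumes k: "1 \<le> k" and w: "k * Suc k + k \<le> w"
    and un: "unavoidable w (\<lambda>f V E. has_mono_clique (Suc k) f V E \<or> (\<exists>\<D>. block_family k (Suc k) f V E \<D>))"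
  shows "unavoidable w (has_mono_clique (Suc k))"
proof (rule unavoidable_extend[OF un upward_closed_has_mono_clique])
  fix Z V :: "nat set" and E \<D>
  assume Z: "finite Z" "V \<inter> Z = {}" and V: "partial_tree w V E"
    and \<D>: "finite \<D>" "card \<D> = Suc k" "\<Union>\<D> \<subseteq> V" "clique E (\<Union>\<D>)" "card (\<Union>\<D>) \<le> k * Suc k"
  let ?C = "\<Union>\<D>"
  have finV: "finite V" and subV: "E \<subseteq> V \<times> V"
    using V clique_built_finite unfolding partial_tree_def by blast+
  have "infinite (- (Z \<union> V))" using Z(1) finV by (simp add: Compl_eq_Diff_UNIV)
  then obtain W where W: "finite W" "card W = card \<D>" "W \<subseteq> - (Z \<union> V)"
    by (metis infinite_arbitrarily_large)
  obtain h where "bij_betw h \<D> W"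
    using W(1,2) \<D>(1) by (metis finite_same_card_bij)
  then have h: "inj_on h \<D>" "h ` \<D> = W" by (auto simp: bij_betw_def)
  let ?K = "W \<times> W - Id"
  let ?X = "{(x, h D) | x D. D \<in> \<D> \<and> x \<in> D}"
  let ?E = "E \<union> ?K \<union> ?X \<union> ?X\<inverse>"
  have bW: "partial_tree k W ?K"
    using clique_built_complete[OF W(1), of k] W(2) \<D>(2)
    unfolding partial_tree_def by (auto simp: sym_def irrefl_def)
  have X: "?X \<subseteq> ?C \<times> W" using h(2) by auto
  have disj: "W \<inter> V = {}" "W \<inter> Z = {}" using W(3) by auto
  have ext: "extends w Z V E (V \<union> W) ?E"
    using V \<D>(3,4,5) bW disj Z(2) w X by (intro extends_attach) auto
  have main: "has_mono_clique (Suc k) f (V \<union> W) ?E"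
    if good: "connected_C4_free f (V \<union> W) ?E" and b: "block_family k (Suc k) f V E \<D>" for f :: "nat \<Rightarrow> nat set"
  proof (rule ccontr)
    assume no: "\<not> has_mono_clique (Suc k) f (V \<union> W) ?E"
    let ?H = "Restr E ?C \<union> ?K \<union> ?X \<union> ?X\<inverse>"
    have gH: "connected_C4_free f (?C \<union> W) ?H"
      using connected_C4_free_attach(2)[OF good subV _ X \<D>(3,4) disj(1)] by blast
    have Dk: "card D = k" "monochromatic f D" "D \<noteq> {}" if "D \<in> \<D>" for D
      using b that k unfolding block_family_def by auto
    have Ddiff: "D = D'" if "D \<in> \<D>" "D' \<in> \<D>" "x \<in> D" "y \<in> D'" "f x = f y" for D D' x y
      using b that unfolding block_family_def by metis
    have own: "f (h D) \<noteq> f x" if "D \<in> \<D>" "x \<in> D" for D x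
    proof
      assume eq: "f (h D) = f x"
      have "has_mono_clique (Suc k) f (V \<union> W) ?E"
      proof (rule has_mono_clique_insert)
        show "D \<subseteq> V \<union> W" "card D = k" "finite D" "monochromatic f D"
          using that \<D>(3) Dk[OF that(1)] finV by (auto intro: finite_subset)
        show "clique ?E D" using \<D>(4) by (rule clique_mono) (use that in auto)
        show "h D \<in> V \<union> W" "h D \<notin> D" using that(1) h(2) disj \<D>(3) by auto
        show "\<forall>u\<in>D. (u, h D) \<in> ?E \<and> (h D, u) \<in> ?E" using that by auto
        show "\<forall>u\<in>D. f u = f (h D)" using eq monochromaticD[OF Dk(2)] that by metis
      qed
      then show False using no by blast
    qed
    have stay: "y \<in> ?C" if "(x, y) \<in> (inner_edges f ?H)\<^sup>*" "x \<in> ?C" for x y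
      using that(1)
    proof (induction rule: rtrancl_induct)
      case base
      then show ?case using that by simp
    next
      case (step y z)
      have yz: "f y = f z" "(y, z) \<in> ?H" using step.hyps(2) by (auto simp: inner_edges_def)
      have "y \<notin> W" using step.IH \<D>(3) disj by blast
      then have "(y, z) \<notin> ?K" "(y, z) \<notin> ?X\<inverse>" using X by auto
      moreover have "(y, z) \<notin> ?X" using own yz(1) by (auto dest: sym)
      ultimately show ?case using yz(2) by blast
    qed
    have conn: "(x, y) \<in> (inner_edges f ?H)\<^sup>*"
      if "x \<in> ?C \<union> W" "y \<in> ?C \<union> W" "f x = f y" for x y
      using gH that unfolding connected_C4_free_def by blast
    have new: "f (h D) \<noteq> f x" if "D \<in> \<D>" "x \<in> ?C" for D x
    proof
      assume "f (h D) = f x"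
      moreover have "h D \<in> W" using that h by blast
      ultimately have "(x, h D) \<in> (inner_edges f ?H)\<^sup>*"
        using conn[of x "h D"] that(2) by simp
      then have "h D \<in> ?C" using stay that(2) by blast
      then show False using \<open>h D \<in> W\<close> \<D>(3) disj by blast
    qed
    have "\<not> monochromatic f W"
    proof
      assume "monochromatic f W"
      moreover have "clique ?E W" by (auto simp: clique_def)
      ultimately have "has_mono_clique (Suc k) f (V \<union> W) ?E"
        unfolding has_mono_clique_def using W(2) \<D>(2) by (intro exI[of _ W]) simp
      then show False using no by blast
    qed
    then obtain u v where "u \<in> W" "v \<in> W" "f u \<noteq> f v" unfolding monochromatic_def by blast
    then obtain D D' where D: "D \<in> \<D>" "D' \<in> \<D>" "f (h D) \<noteq> f (h D')" using h(2) by blast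
    obtain x x' where x: "x \<in> D" "x' \<in> D'" using Dk(3) D by blast
    have xx': "f x \<noteq> f x'" using Ddiff[OF D(1,2) x] D(3) by auto
    have xC: "x \<in> ?C" "x' \<in> ?C" using x D by auto
    \<comment> \<open>An old and a new label touch only if the edge joins a block to its own new vertex.\<close>
    have cross: "\<not> touching f ?H p q \<and> \<not> touching f ?H q p"
      if p: "p = f y" "y \<in> D1" "D1 \<in> \<D>" and q: "q = f (h D2)" "D2 \<in> \<D>" "f (h D1) \<noteq> f (h D2)"
      for p q y D1 D2
    proof -
      have no_edge: False if e: "(u, v) \<in> ?H \<or> (v, u) \<in> ?H" "f u = f y" "f v = f (h D2)" for u v
      proof -
        have "v \<notin> ?C" using new[OF q(2), of v] e(3) by metis
        moreover have "u \<notin> W"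
        proof
          assume "u \<in> W"
          then obtain D3 where "D3 \<in> \<D>" "u = h D3" using h(2) by blast
          then show False using new[of D3 y] e(2) p by auto
        qed
        ultimately have "(u, v) \<in> ?X" using e(1) X by auto
        then obtain D3 where D3: "D3 \<in> \<D>" "u \<in> D3" "v = h D3" by blast
        then have "D3 = D1" using Ddiff[OF D3(1) p(3) D3(2) p(2) e(2)] by blast
        then show False using D3 q(3) e(3) by simp
      qed
      show ?thesis
        unfolding touching_def p(1) q(1)
        by (intro conjI notI; elim exE conjE) (erule (2) no_edge[OF disjI1] no_edge[OF disjI2])+
    qed
    have XH: "(x, h D) \<in> ?H" "(h D, x) \<in> ?H" "(x', h D') \<in> ?H" "(h D', x') \<in> ?H"
      using x D by auto
    have "h D \<noteq> h D'" "x \<noteq> x'" using D xx' by auto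
    then have "(h D, h D') \<in> ?H" "(x', x) \<in> ?H"
      using h D xC cliqueD[OF \<D>(4), of x' x] by auto
    then have touch: "touching f ?H (f x) (f (h D))" "touching f ?H (f (h D)) (f (h D'))"
      "touching f ?H (f (h D')) (f x')" "touching f ?H (f x') (f x)"
      using XH by (simp_all only: touchingI)
    have "\<not> touching f ?H (f x) (f (h D'))" "\<not> touching f ?H (f (h D)) (f x')"
      using cross[OF refl x(1) D(1) refl D(2,3)] cross[OF refl x(2) D(2) refl D(1) D(3)[symmetric]]
      by blast+
    moreover have "distinct [f x, f (h D), f (h D'), f x']"
      using D(3) xx' new[OF D(1) xC(1)] new[OF D(1) xC(2)] new[OF D(2) xC(1)] new[OF D(2) xC(2)]
      by auto
    ultimately have "induced_C4 f ?H (f x) (f (h D)) (f (h D')) (f x')"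
      using touch unfolding induced_C4_def by blast
    then show False using gH unfolding connected_C4_free_def by blast
  qed
  show "\<exists>V' E'. extends w Z V E V' E' \<and> (\<forall>f :: nat \<Rightarrow> nat set. connected_C4_free f V' E' \<longrightarrow>
      block_family k (Suc k) f V E \<D> \<longrightarrow> has_mono_clique (Suc k) f V' E')"
    by (intro exI[of _ "V \<union> W"] exI[of _ ?E] conjI allI impI ext main)
qed

lemma unavoidable_blocks:
  assumes mono: "unavoidable w0 (has_mono_clique k)" and k: "1 \<le> k"
  shows "unavoidable (w0 + k * r) (\<lambda>f V E. has_mono_clique (Suc k) f V E \<or> (\<exists>\<D>. block_family k (Suc r) f V E \<D>))"
proof (induction r)
  case 0
  have "block_family k (Suc 0) f V E {D}"
    if "D \<subseteq> V" "card D = k" "clique E D" "monochromatic f D" for D V E and f :: "nat \<Rightarrow> nat set"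
    using that by (simp add: block_family_def)
  then have "has_mono_clique k f V E \<Longrightarrow> \<exists>\<D>. block_family k (Suc 0) f V E \<D>" for V E and f :: "nat \<Rightarrow> nat set"
    unfolding has_mono_clique_def by blast
  then show ?case
    using unavoidable_imp[OF mono] by simp
next
  case (Suc r)
  then show ?case
    by (intro unavoidable_Suc_blocks[OF mono k _ unavoidable_width_le[OF Suc]]) simp_all
qed

text \<open>
  The polynomial exceeds six times \<open>1\<^sup>2 + \<dots> + (k - 1)\<^sup>2\<close> by 18. So it grows by \<open>6 * k\<^sup>2\<close> from \<open>k\<close> to
  \<open>k + 1\<close>, which pays for the \<open>k + 1\<close> blocks of size \<open>k\<close>. The gadget that joins the blocks also needs
  \<open>k\<^sup>2 + 2 * k \<le> w\<close>; the constant 18 is the least one that allows this for all \<open>k\<close>.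
\<close>

lemma unavoidable_has_mono_clique:
  assumes "1 \<le> k" "2 * int k ^ 3 - 3 * int k ^ 2 + int k + 18 \<le> 6 * int w"
  shows "unavoidable w (has_mono_clique k)"
  using assms
proof (induction k arbitrary: w rule: nat_induct_at_least)
  case base
  have "unavoidable 0 (has_mono_clique 1)"
    unfolding unavoidable_def
  proof (intro allI impI)
    fix Z :: "nat set" assume "finite Z"
    then obtain v where v: "v \<notin> Z" by (meson ex_new_if_finite infinite_UNIV_nat)
    have "clique_built 0 {v} {}"
      using clique_built_complete[of "{v}" 0] by simp
    then have "partial_tree 0 {v} {}" by (auto simp: partial_tree_def sym_def irrefl_def)
    moreover have "has_mono_clique 1 f {v} {}" for f :: "nat \<Rightarrow> nat set"
      unfolding has_mono_clique_def by (intro exI[of _ "{v}"]) (auto simp: clique_def monochromatic_def)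
    ultimately show "\<exists>V E. V \<inter> Z = {} \<and> partial_tree 0 V E \<and>
        (\<forall>f :: nat \<Rightarrow> nat set. connected_C4_free f V E \<longrightarrow> has_mono_clique 1 f V E)"
      using v by (intro exI[of _ "{v}"] exI[of _ "{}"]) simp
  qed
  then show ?case by (rule unavoidable_width_le) simp
next
  case (Suc k)
  have poly: "2 * (int k + 1) ^ 3 - 3 * (int k + 1) ^ 2 + (int k + 1) + 18
      = (2 * int k ^ 3 - 3 * int k ^ 2 + int k + 18) + 6 * int k ^ 2"
    by (simp add: power2_eq_square power3_eq_cube algebra_simps)
  have w: "(2 * int k ^ 3 - 3 * int k ^ 2 + int k + 18) + 6 * int k ^ 2 \<le> 6 * int w"
    using Suc.prems poly by (simp add: add.commute)
  \<comment> \<open>The polynomial at \<open>k + 1\<close> minus \<open>6 * (k\<^sup>2 + 2 * k)\<close>, factored.\<close>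
  have "0 \<le> (int k - 2) * (2 * int k ^ 2 + int k - 9)"
  proof (cases "k \<le> 1")
    case True
    then have "k = 1" using Suc.hyps by simp
    then show ?thesis by simp
  next
    case False
    then have "2 ^ 2 \<le> int k ^ 2" by (intro power_mono) auto
    then show ?thesis using False by (intro mult_nonneg_nonneg) auto
  qed
  then have "6 * (int k ^ 2 + 2 * int k) \<le> 6 * int w"
    using w by (simp add: power2_eq_square power3_eq_cube algebra_simps)
  then have kw: "k * Suc k + k \<le> w"
    by (simp add: power2_eq_square flip: of_nat_mult of_nat_add)
  then have "k * k \<le> w" by simp
  have "unavoidable (w - k * k) (has_mono_clique k)"
    using w \<open>k * k \<le> w\<close> by (intro Suc.IH) (simp add: of_nat_diff power2_eq_square)
  then have "unavoidable (w - k * k + k * k)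
      (\<lambda>f V E. has_mono_clique (Suc k) f V E \<or> (\<exists>\<D>. block_family k (Suc k) f V E \<D>))"
    using Suc.hyps by (rule unavoidable_blocks)
  then show ?case
    using \<open>k * k \<le> w\<close> kw Suc.hyps by (intro unavoidable_mono_Suc) auto
qed

section \<open>Connected vertex sets\<close>

definition linked :: "'a rel \<Rightarrow> 'a set \<Rightarrow> bool" where
  "linked E S \<longleftrightarrow> (\<forall>x\<in>S. \<forall>y\<in>S. (x, y) \<in> (Restr E S)\<^sup>*)"

lemma linkedD: "linked E S \<Longrightarrow> x \<in> S \<Longrightarrow> y \<in> S \<Longrightarrow> (x, y) \<in> (Restr E S)\<^sup>*"
  unfolding linked_def by blast

lemma linked_mono: "linked E S \<Longrightarrow> E \<subseteq> F \<Longrightarrow> linked F S"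
  unfolding linked_def using rtrancl_mono[of "Restr E S" "Restr F S"] by blast

lemma connected_restrict_iff:
  assumes "sym (parcs G)"
  shows "connected (with_proj G \<restriction> S) \<longleftrightarrow> S \<noteq> {} \<and> linked (parcs G) S"
proof -
  let ?M = "mk_symmetric (with_proj G \<restriction> S)"
  have M: "pverts ?M = S" "parcs ?M = Restr (parcs G) S"
    using assms by (auto simp: mk_symmetric_def sym_def)
  interpret M: pair_wf_digraph ?M
    by unfold_locales (auto simp: M)
  have "reachable (with_proj ?M) u v \<longleftrightarrow> (u, v) \<in> (Restr (parcs G) S)\<^sup>*" if "u \<in> S" for u v
    using M.reachable_conv'[of u v] that by (simp add: M)
  then show ?thesis
    unfolding connected_def strongly_connected_def linked_def by (simp add: M)
qed

lemma connected_with_proj_iff: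
  assumes "sym (parcs G)" "parcs G \<subseteq> pverts G \<times> pverts G"
  shows "connected (with_proj G) \<longleftrightarrow> pverts G \<noteq> {} \<and> linked (parcs G) (pverts G)"
proof -
  have "with_proj G \<restriction> pverts G = with_proj G"
    using assms(2) by (auto simp: induce_subgraph_def with_proj_def)
  then show ?thesis using connected_restrict_iff[OF assms(1), of "pverts G"] by simp
qed

section \<open>Clique minors\<close>

text \<open>
  The neighbours of \<open>v\<close> form a clique, so a walk through \<open>v\<close> can take a short cut around it.
\<close>

lemma rtrancl_remove_simplicial:
  assumes F: "F \<subseteq> V \<times> V" "clique F N" "v \<notin> V" "N \<subseteq> V"
    and walk: "(x, z) \<in> (Restr (F \<union> {v} \<times> N \<union> N \<times> {v}) S)\<^sup>*" and x: "x \<in> S - {v}"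
  shows "(z \<noteq> v \<longrightarrow> (x, z) \<in> (Restr F (S - {v}))\<^sup>*) \<and>
    (z = v \<longrightarrow> (\<exists>c\<in>N \<inter> S. (x, c) \<in> (Restr F (S - {v}))\<^sup>*))"
  using walk
proof (induction rule: rtrancl_induct)
  case base
  then show ?case using x by simp
next
  case (step y z)
  let ?R = "Restr F (S - {v})"
  have vF: "(v, u) \<notin> F" "(u, v) \<notin> F" "v \<notin> N" for u using F by auto
  show ?case
  proof (cases "y = v")
    case True
    then obtain c where c: "c \<in> N \<inter> S" "(x, c) \<in> ?R\<^sup>*" using step.IH by blast
    have z: "z \<in> N \<inter> S" "z \<noteq> v" using step.hyps(2) True vF by auto
    have "(x, z) \<in> ?R\<^sup>*"
    proof (cases "c = z")
      case False
      then have "(c, z) \<in> ?R" using c z cliqueD[OF F(2)] vF by auto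
      then show ?thesis using c(2) by (rule rtrancl.rtrancl_into_rtrancl[rotated])
    qed (use c in simp)
    then show ?thesis using z by blast
  next
    case False
    then have xy: "(x, y) \<in> ?R\<^sup>*" using step.IH by blast
    show ?thesis
    proof (cases "z = v")
      case True
      then have "y \<in> N \<inter> S" using step.hyps(2) False vF by auto
      then show ?thesis using xy True by blast
    next
      case zv: False
      then have "(y, z) \<in> ?R" using step.hyps(2) False by auto
      then have "(x, z) \<in> ?R\<^sup>*" using xy by (rule rtrancl.rtrancl_into_rtrancl[rotated])
      then show ?thesis using zv by blast
    qed
  qed
qed

text \<open>
  The last vertex \<open>v\<close> has a clique of at most \<open>w\<close> neighbours. If \<open>{v}\<close> is a branch set, every other
  branch set contains a neighbour of \<open>v\<close>, and there are at most \<open>w\<close> of these. Otherwise \<open>v\<close> can be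
  removed from its branch set, which stays connected and keeps a neighbour of \<open>v\<close>, and this neighbour
  is adjacent to all other neighbours of \<open>v\<close>.
\<close>

lemma clique_built_minor:
  assumes "clique_built w V F" "finite X"
    and "\<And>x. x \<in> X \<Longrightarrow> \<phi> x \<noteq> {} \<and> \<phi> x \<subseteq> V \<and> linked F (\<phi> x)"
    and "\<And>x y. x \<in> X \<Longrightarrow> y \<in> X \<Longrightarrow> x \<noteq> y \<Longrightarrow> \<phi> x \<inter> \<phi> y = {}"
    and "\<And>x y. x \<in> X \<Longrightarrow> y \<in> X \<Longrightarrow> x \<noteq> y \<Longrightarrow> \<exists>u\<in>\<phi> x. \<exists>v\<in>\<phi> y. (u, v) \<in> F"
  shows "card X \<le> Suc w"
  using assms
proof (induction arbitrary: \<phi> rule: clique_built.induct)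
  case empty
  then have "X = {}" by blast
  then show ?case by simp
next
  case (add V F v N)
  let ?F = "F \<union> {v} \<times> N \<union> N \<times> {v}"
  note FV = clique_built_subset[OF add.hyps(1)]
  have symF: "sym F" using add.hyps(1) by (rule clique_built_sym)
  have vF: "(v, u) \<notin> F" "(u, v) \<notin> F" "v \<notin> N" for u using FV add.hyps(2,3) by auto
  note br = add.prems(2) and disj = add.prems(3) and adj = add.prems(4)
  note remove = rtrancl_remove_simplicial[OF FV add.hyps(4,2,3)]
  have linked_remove: "linked F (S - {v})" if "linked ?F S" for S
    unfolding linked_def using remove[OF linkedD[OF that]] by blast
  show ?case
  proof (cases "\<exists>x0\<in>X. \<phi> x0 = {v}")
    case True
    then obtain x0 where x0: "x0 \<in> X" "\<phi> x0 = {v}" by blast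
    \<comment> \<open>Every other branch set uses up a neighbour of \<open>v\<close>.\<close>
    have "\<exists>c. c \<in> N \<and> c \<in> \<phi> y" if "y \<in> X - {x0}" for y
      using adj[OF x0(1), of y] that x0(2) vF by auto
    then obtain g where g: "g y \<in> N \<and> g y \<in> \<phi> y" if "y \<in> X - {x0}" for y
      by metis
    have "inj_on g (X - {x0})"
    proof (rule inj_onI)
      fix y z assume yz: "y \<in> X - {x0}" "z \<in> X - {x0}" "g y = g z"
      then have "g y \<in> \<phi> y \<inter> \<phi> z" using g by (metis IntI)
      then show "y = z" using disj yz by blast
    qed
    moreover have "g ` (X - {x0}) \<subseteq> N" using g by blast
    moreover have "finite N"
      using add.hyps(1,3) clique_built_finite finite_subset by metis
    ultimately have "card (X - {x0}) \<le> card N" by (metis card_inj_on_le)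
    then show ?thesis using add.hyps(5) x0(1) add.prems(1) by (simp add: card_Diff_singleton)
  next
    case False
    have "card X \<le> Suc w"
    proof (rule add.IH[of "\<lambda>x. \<phi> x - {v}"])
      show "finite X" by (rule add.prems(1))
      show "\<phi> x - {v} \<noteq> {} \<and> \<phi> x - {v} \<subseteq> V \<and> linked F (\<phi> x - {v})" if "x \<in> X" for x
        using br[OF that] False that linked_remove by blast
      show "(\<phi> x - {v}) \<inter> (\<phi> y - {v}) = {}" if "x \<in> X" "y \<in> X" "x \<noteq> y" for x y
        using disj[OF that] by blast
      have nb: "\<exists>c\<in>N \<inter> \<phi> x. c \<noteq> v" if xv: "x \<in> X" "v \<in> \<phi> x" for x
      proof -
        obtain y where "y \<in> \<phi> x - {v}" using br[OF xv(1)] False xv(1) by blast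
        then have "(y, v) \<in> (Restr ?F (\<phi> x))\<^sup>*"
          using linkedD[of ?F "\<phi> x" y v] br[OF xv(1)] xv(2) by simp
        then obtain c where "c \<in> N \<inter> \<phi> x"
          using remove[OF _ \<open>y \<in> \<phi> x - {v}\<close>, of v] by blast
        then show ?thesis using vF(3) by (intro bexI[of _ c]) auto
      qed
      have half: "\<exists>u\<in>\<phi> x - {v}. \<exists>w\<in>\<phi> y - {v}. (u, w) \<in> F"
        if xy: "x \<in> X" "y \<in> X" "x \<noteq> y" "v \<notin> \<phi> y" for x y
      proof -
        obtain u w where uw: "u \<in> \<phi> x" "w \<in> \<phi> y" "(u, w) \<in> ?F" using adj[OF xy(1-3)] by blast
        show ?thesis
        proof (cases "u = v")
          case True
          then have "w \<in> N" using uw(3) vF by auto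
          obtain c where c: "c \<in> N \<inter> \<phi> x" "c \<noteq> v" using nb xy(1) uw(1) True by blast
          have "c \<noteq> w" using c(1) uw(2) disj[OF xy(1-3)] by blast
          then have "(c, w) \<in> F" using cliqueD[OF add.hyps(4)] c(1) \<open>w \<in> N\<close> by blast
          then show ?thesis using c uw(2) xy(4) by blast
        next
          case False
          then show ?thesis using uw xy(4) by blast
        qed
      qed
      show "\<exists>u\<in>\<phi> x - {v}. \<exists>w\<in>\<phi> y - {v}. (u, w) \<in> F" if xy: "x \<in> X" "y \<in> X" "x \<noteq> y" for x y
      proof (cases "v \<in> \<phi> y")
        case True
        then have "v \<notin> \<phi> x" using disj[OF xy] by blast
        then show ?thesis using half[OF xy(2,1) xy(3)[symmetric]] symD[OF symF] by blast
      next
        case False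
        then show ?thesis using half[OF xy] by blast
      qed
    qed
    then show ?thesis .
  qed
qed

lemma partial_tree_no_minor:
  assumes "partial_tree w V E" "Suc w < n"
  shows "\<not> has_minor \<lparr>pverts = V, parcs = E\<rparr> (complete_graph n)"
proof
  let ?G = "\<lparr>pverts = V, parcs = E\<rparr>"
  assume "has_minor ?G (complete_graph n)"
  then obtain \<phi> where \<phi>: "\<forall>x\<in>{..<n}. \<phi> x \<subseteq> V \<and> connected (with_proj ?G \<restriction> \<phi> x)"
    "\<forall>x\<in>{..<n}. \<forall>y\<in>{..<n}. x \<noteq> y \<longrightarrow> \<phi> x \<inter> \<phi> y = {}"
    "\<forall>x\<in>{..<n}. \<forall>y\<in>{..<n}. x \<noteq> y \<longrightarrow> (\<exists>u\<in>\<phi> x. \<exists>v\<in>\<phi> y. (u, v) \<in> E)"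
    unfolding has_minor_def complete_graph_def by auto
  obtain F where F: "clique_built w V F" "E \<subseteq> F" and "sym E"
    using assms(1) unfolding partial_tree_def by blast
  have "card {..<n} \<le> Suc w"
  proof (rule clique_built_minor[OF F(1)])
    show "\<phi> x \<noteq> {} \<and> \<phi> x \<subseteq> V \<and> linked F (\<phi> x)" if "x \<in> {..<n}" for x
      using \<phi>(1) that connected_restrict_iff[of ?G] \<open>sym E\<close> linked_mono[OF _ F(2)] by auto
    show "\<phi> x \<inter> \<phi> y = {}" if "x \<in> {..<n}" "y \<in> {..<n}" "x \<noteq> y" for x y
      using \<phi>(2) that by blast
    show "\<exists>u\<in>\<phi> x. \<exists>v\<in>\<phi> y. (u, v) \<in> F" if "x \<in> {..<n}" "y \<in> {..<n}" "x \<noteq> y" for x y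
      using \<phi>(3) that F(2) by blast
  qed simp
  then show False using assms(2) by simp
qed

section \<open>Tree-width\<close>

text \<open>
  A rooted tree on \<open>{..n}\<close> with root \<open>0\<close>, provided that \<open>p i < i\<close> for all other nodes.
\<close>

definition parent_tree :: "nat \<Rightarrow> (nat \<Rightarrow> nat) \<Rightarrow> nat pair_pre_digraph" where
  "parent_tree n p = \<lparr>pverts = {..n},
     parcs = {(i, p i) | i. 0 < i \<and> i \<le> n} \<union> {(p i, i) | i. 0 < i \<and> i \<le> n}\<rparr>"

lemma parent_tree_simps [simp]:
  "pverts (parent_tree n p) = {..n}"
  "parcs (parent_tree n p) = {(i, p i) | i. 0 < i \<and> i \<le> n} \<union> {(p i, i) | i. 0 < i \<and> i \<le> n}"
  by (simp_all add: parent_tree_def)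

lemma parent_tree_sym: "sym (parcs (parent_tree n p))"
  by (auto simp: sym_def)

text \<open>
  Following parents leads from every node of \<open>S\<close> to \<open>r\<close> without leaving \<open>S\<close>.
\<close>

lemma parent_tree_linked:
  assumes p: "\<And>i. 0 < i \<Longrightarrow> i \<le> n \<Longrightarrow> p i < i"
    and S: "S \<subseteq> {..n}" "r \<in> S" "\<And>i. i \<in> S \<Longrightarrow> i \<noteq> r \<Longrightarrow> 0 < i \<and> p i \<in> S"
  shows "linked (parcs (parent_tree n p)) S"
proof -
  let ?R = "Restr (parcs (parent_tree n p)) S"
  have up: "(i, r) \<in> ?R\<^sup>*" if "i \<in> S" for i
    using that
  proof (induction i rule: less_induct)
    case (less i)
    show ?case
    proof (cases "i = r")
      case False
      then have "0 < i" "p i \<in> S" "i \<le> n" using S less.prems by auto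
      then have "(i, p i) \<in> ?R" "(p i, r) \<in> ?R\<^sup>*" using less p by auto
      then show ?thesis by (rule converse_rtrancl_into_rtrancl)
    qed simp
  qed
  have "sym ?R" using parent_tree_sym[of n p] by (auto simp: sym_def)
  then have "(r, i) \<in> ?R\<^sup>*" if "i \<in> S" for i
    using up[OF that] by (metis sym_rtrancl symD)
  then show ?thesis
    unfolding linked_def using up by (meson rtrancl_trans)
qed

lemma pcas_nth:
  "pcas u q v \<Longrightarrow> Suc j < length q \<Longrightarrow> snd (q ! j) = fst (q ! Suc j)"
proof (induction q arbitrary: u j)
  case (Cons e q)
  show ?case
  proof (cases j)
    case 0
    then show ?thesis using Cons.prems by (cases q) auto
  next
    case (Suc i)
    then show ?thesis using Cons by auto
  qed
qed simp

lemma pcas_ends: "pcas u q v \<Longrightarrow> q \<noteq> [] \<Longrightarrow> fst (q ! 0) = u \<and> snd (q ! (length q - 1)) = v"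
proof (induction q arbitrary: u)
  case (Cons e q)
  then show ?case by (cases q) auto
qed simp

lemma pawalk_verts_map: "pcas u q v \<Longrightarrow> pawalk_verts u q = map fst q @ [v]"
  by (induction q arbitrary: u) auto

text \<open>
  The largest node of a cycle has two different smaller neighbours on it, but the only smaller
  neighbour of a node is its parent.
\<close>

lemma parent_tree_no_cycle:
  assumes p: "\<And>i. 0 < i \<Longrightarrow> i \<le> n \<Longrightarrow> p i < i"
    and cyc: "pre_digraph.cycle (with_proj (parent_tree n p)) q"
  shows "length q < 3"
proof (rule ccontr)
  assume "\<not> length q < 3"
  then have len: "3 \<le> length q" by simp
  interpret T: pair_pre_digraph "parent_tree n p" .
  obtain u where u: "pcas u q u" "set q \<subseteq> parcs (parent_tree n p)" "distinct (tl (pawalk_verts u q))"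
    using cyc unfolding T.cycle_def T.awalk_def by auto
  define m where "m = length q"
  define x where "x j = fst (q ! j)" for j
  define nxt where "nxt j = (if Suc j = m then 0 else Suc j)" for j
  define prv where "prv j = (if j = 0 then m - 1 else j - 1)" for j
  have "q \<noteq> []" using len by auto
  then have "distinct (map fst q)"
    using u(1,3) pcas_ends[OF u(1)] unfolding pawalk_verts_map[OF u(1)]
    by (cases q) auto
  then have x_inj: "x i = x j \<Longrightarrow> i < m \<Longrightarrow> j < m \<Longrightarrow> i = j" for i j
    unfolding x_def m_def by (simp add: distinct_conv_nth) metis
  have q_nth: "q ! j = (x j, x (nxt j))" if "j < m" for j
  proof (cases "Suc j = m")
    case True
    then have "j = length q - 1" by (simp add: m_def)
    then show ?thesis
      using pcas_ends[OF u(1) \<open>q \<noteq> []\<close>] True unfolding x_def nxt_def by (auto simp: prod_eq_iff)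
  next
    case False
    then show ?thesis
      using pcas_nth[OF u(1), of j] that unfolding x_def nxt_def m_def by (auto simp: prod_eq_iff)
  qed
  have arc: "(x j, x (nxt j)) \<in> parcs (parent_tree n p)" if "j < m" for j
    using q_nth[OF that] u(2) that unfolding m_def by (metis nth_mem subsetD)
  \<comment> \<open>At its largest vertex the cycle would have to come from and go to the parent.\<close>
  obtain j where j: "j < m" "\<And>i. i < m \<Longrightarrow> x i \<le> x j"
  proof -
    have "0 \<in> {..<m}" using len by (simp add: m_def del: length_greater_0_conv)
    then have "finite (x ` {..<m})" "x ` {..<m} \<noteq> {}" by blast+
    then have "Max (x ` {..<m}) \<in> x ` {..<m}" by (rule Max_in)
    then obtain j where "j < m" "x j = Max (x ` {..<m})" by auto
    then show ?thesis using that[of j] by simp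
  qed
  have nj: "nxt j < m" "prv j < m" "nxt (prv j) = j" "nxt j \<noteq> prv j"
    using j(1) len unfolding nxt_def prv_def m_def by auto
  have up: "b = p a" if "(a, b) \<in> parcs (parent_tree n p) \<or> (b, a) \<in> parcs (parent_tree n p)" "b \<le> a" for a b
    using that p[of a] p[of b] by auto
  have "x (nxt j) = p (x j)" using up arc[OF j(1)] j(2)[OF nj(1)] by blast
  moreover have "x (prv j) = p (x j)" using up arc[OF nj(2)] j(2)[OF nj(2)] nj(3) by metis
  ultimately show False using x_inj nj by metis
qed

lemma parent_tree_undirected_tree:
  assumes p: "\<And>i. 0 < i \<Longrightarrow> i \<le> n \<Longrightarrow> p i < i"
  shows "undirected_tree (parent_tree n p)"
proof -
  have sub: "parcs (parent_tree n p) \<subseteq> {..n} \<times> {..n}"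
  proof (clarsimp, safe)
    fix i assume "0 < i" "i \<le> n"
    then show "p i \<le> n" using p[of i] by simp
    then show "p i \<le> n" .
  qed
  have "pair_graph (parent_tree n p)"
  proof
    fix e assume e: "e \<in> parcs (parent_tree n p)"
    then show "fst e \<in> pverts (parent_tree n p)" "snd e \<in> pverts (parent_tree n p)"
      using sub by auto
    obtain i where "0 < i" "i \<le> n" "e = (i, p i) \<or> e = (p i, i)" using e by auto
    then show "fst e \<noteq> snd e" using p[of i] by auto
  next
    show "finite (pverts (parent_tree n p))" by simp
    show "finite (parcs (parent_tree n p))" using sub by (rule finite_subset) simp
    show "symmetric (with_proj (parent_tree n p))"
      using parent_tree_sym unfolding symmetric_def by simp
  qed
  moreover have "linked (parcs (parent_tree n p)) {..n}"
  proof (rule parent_tree_linked)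
    show "0 < i \<and> p i \<in> {..n}" if "i \<in> {..n}" "i \<noteq> 0" for i
      using that p[of i] by auto
  qed (use p in auto)
  then have "connected (with_proj (parent_tree n p))"
    using connected_with_proj_iff[OF parent_tree_sym] sub by auto
  ultimately show ?thesis
    unfolding undirected_tree_def using parent_tree_no_cycle[OF p] by (meson not_less)
qed

text \<open>
  A new vertex \<open>v\<close> attached to \<open>N\<close> yields a new bag \<open>insert v N\<close>, whose parent is an old bag containing
  the clique \<open>N\<close>. The last conjunct says that the bags containing a given vertex form a subtree with
  root \<open>r\<close>, in a form that is preserved when leaves are added.
\<close>

lemma clique_built_bags:
  assumes "clique_built w V F"
  shows "\<exists>(n :: nat) p B. (\<forall>i. 0 < i \<and> i \<le> n \<longrightarrow> p i < i) \<and> (\<forall>i\<le>n. B i \<subseteq> V \<and> card (B i) \<le> Suc w) \<and>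
    (\<forall>S\<subseteq>V. clique F S \<longrightarrow> (\<exists>i\<le>n. S \<subseteq> B i)) \<and>
    (\<forall>v\<in>V. \<exists>r\<le>n. v \<in> B r \<and> (\<forall>i\<le>n. v \<in> B i \<and> i \<noteq> r \<longrightarrow> 0 < i \<and> v \<in> B (p i)))"
  using assms
proof (induction rule: clique_built.induct)
  case empty
  show ?case
    by (intro exI[of _ 0] exI[of _ "\<lambda>_. 0"] exI[of _ "\<lambda>_. {}"]) auto
next
  case (add V F v N)
  then obtain n :: nat and p B where p: "\<forall>i. 0 < i \<and> i \<le> n \<longrightarrow> p i < i"
    and B: "\<forall>i\<le>n. B i \<subseteq> V \<and> card (B i) \<le> Suc w"
    and cl: "\<forall>S\<subseteq>V. clique F S \<longrightarrow> (\<exists>i\<le>n. S \<subseteq> B i)"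
    and sub: "\<forall>u\<in>V. \<exists>r\<le>n. u \<in> B r \<and> (\<forall>i\<le>n. u \<in> B i \<and> i \<noteq> r \<longrightarrow> 0 < i \<and> u \<in> B (p i))"
    by (elim exE conjE)
  have p: "\<And>i. 0 < i \<Longrightarrow> i \<le> n \<Longrightarrow> p i < i" using p by simp
  note B = B[rule_format] and cl = cl[rule_format] and sub = bspec[OF sub]
  obtain k where k: "k \<le> n" "N \<subseteq> B k" using cl[OF add.hyps(3,4)] by blast
  let ?F = "F \<union> {v} \<times> N \<union> N \<times> {v}"
  define p' where "p' = p(Suc n := k)"
  define B' where "B' = B(Suc n := insert v N)"
  have FV: "F \<subseteq> V \<times> V" using add.hyps(1) by (rule clique_built_subset)
  have finN: "finite N" using add.hyps(1,3) clique_built_finite finite_subset by metis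
  have old: "p' i = p i" "B' i = B i" if "i \<le> n" for i
    using that by (simp_all add: p'_def B'_def)
  have new: "p' (Suc n) = k" "B' (Suc n) = insert v N"
    by (simp_all add: p'_def B'_def)
  have le: "i \<le> Suc n \<longleftrightarrow> i \<le> n \<or> i = Suc n" for i by auto
  show ?case
  proof (rule exI[of _ "Suc n"], rule exI[of _ p'], rule exI[of _ B'], intro conjI allI impI ballI)
    fix i assume "0 < i \<and> i \<le> Suc n"
    then show "p' i < i" using p k(1) old new by (auto simp: le)
  next
    fix i assume i: "i \<le> Suc n"
    show "B' i \<subseteq> insert v V"
      using i B[of i] old(2)[of i] new(2) add.hyps(3) by (auto simp: le)
    have "card (insert v N) \<le> Suc w" using add.hyps(5) finN by (simp add: card_insert_if)
    then show "card (B' i) \<le> Suc w" using i B old new by (auto simp: le)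
  next
    fix S assume S: "S \<subseteq> insert v V" "clique ?F S"
    show "\<exists>i\<le>Suc n. S \<subseteq> B' i"
    proof (cases "v \<in> S")
      case True
      have "S \<subseteq> insert v N"
      proof
        fix u assume "u \<in> S"
        then show "u \<in> insert v N"
          using cliqueD[OF S(2) True, of u] FV add.hyps(2) by auto
      qed
      then show ?thesis using new by blast
    next
      case False
      have "clique F S" using S(2) False unfolding clique_def by blast
      then obtain i where "i \<le> n" "S \<subseteq> B i" using cl[of S] S(1) False by blast
      then show ?thesis using old by (metis le)
    qed
  next
    fix u assume u: "u \<in> insert v V"
    show "\<exists>r\<le>Suc n. u \<in> B' r \<and> (\<forall>i\<le>Suc n. u \<in> B' i \<and> i \<noteq> r \<longrightarrow> 0 < i \<and> u \<in> B' (p' i))"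
    proof (cases "u = v")
      case True
      have "u \<notin> B' i" if "i \<le> n" for i using B[OF that] old(2)[OF that] True add.hyps(2) by blast
      then show ?thesis using new True by (intro exI[of _ "Suc n"]) (auto simp: le)
    next
      case False
      then obtain r where r: "r \<le> n" "u \<in> B r"
        and ri: "\<And>i. i \<le> n \<Longrightarrow> u \<in> B i \<Longrightarrow> i \<noteq> r \<Longrightarrow> 0 < i \<and> u \<in> B (p i)"
        using sub[of u] u by blast
      have "0 < i \<and> u \<in> B' (p' i)" if i: "i \<le> Suc n" "u \<in> B' i" "i \<noteq> r" for i
      proof (cases "i = Suc n")
        case True
        then have "u \<in> B k" using i(2) new False k(2) by auto
        then show ?thesis using True new old[OF k(1)] by simp
      next
        case ni: False
        then have "i \<le> n" using i(1) by simp
        then have "0 < i" "u \<in> B (p i)" using ri i old by auto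
        then show ?thesis using p[of i] \<open>i \<le> n\<close> old by simp
      qed
      then show ?thesis using r old(2)[OF r(1)] by (intro exI[of _ r]) auto
    qed
  qed
qed

lemma partial_tree_treewidth:
  assumes "partial_tree w V E"
  shows "treewidth \<lparr>pverts = V, parcs = E\<rparr> \<le> w"
proof -
  obtain F where F: "clique_built w V F" "E \<subseteq> F" and E: "E \<subseteq> V \<times> V" "sym E"
    using assms unfolding partial_tree_def by blast
  obtain n :: nat and p B where p: "\<forall>i. 0 < i \<and> i \<le> n \<longrightarrow> p i < i"
    and B: "\<forall>i\<le>n. B i \<subseteq> V \<and> card (B i) \<le> Suc w"
    and cl: "\<forall>S\<subseteq>V. clique F S \<longrightarrow> (\<exists>i\<le>n. S \<subseteq> B i)"
    and sub: "\<forall>u\<in>V. \<exists>r\<le>n. u \<in> B r \<and> (\<forall>i\<le>n. u \<in> B i \<and> i \<noteq> r \<longrightarrow> 0 < i \<and> u \<in> B (p i))"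
    using clique_built_bags[OF F(1)] by (elim exE conjE)
  have p: "\<And>i. 0 < i \<Longrightarrow> i \<le> n \<Longrightarrow> p i < i" using p by simp
  note B = B[rule_format] and cl = cl[rule_format] and sub = bspec[OF sub]
  let ?T = "parent_tree n p" and ?G = "\<lparr>pverts = V, parcs = E\<rparr>"
  have "tree_decomposition ?G ?T B"
    unfolding tree_decomposition_def
  proof (intro conjI ballI)
    show "undirected_tree ?T" using p by (rule parent_tree_undirected_tree)
    show "B i \<subseteq> pverts ?G" if "i \<in> pverts ?T" for i using B that by simp
  next
    fix e assume "e \<in> parcs ?G"
    then obtain u v where e: "e = (u, v)" "(u, v) \<in> E" by (cases e) auto
    have "clique F {u, v}"
      using e(2) F(2) E(2) unfolding clique_def sym_def by blast
    then obtain i where "i \<le> n" "{u, v} \<subseteq> B i" using cl[of "{u, v}"] e(2) E(1) by blast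
    then show "case e of (u, v) \<Rightarrow> \<exists>i\<in>pverts ?T. u \<in> B i \<and> v \<in> B i"
      using e(1) by auto
  next
    fix v assume "v \<in> pverts ?G"
    then obtain r where r: "r \<le> n" "v \<in> B r"
      and ri: "\<And>i. i \<le> n \<Longrightarrow> v \<in> B i \<Longrightarrow> i \<noteq> r \<Longrightarrow> 0 < i \<and> v \<in> B (p i)"
      using sub[of v] by auto
    let ?S = "{i \<in> pverts ?T. v \<in> B i}"
    have "linked (parcs ?T) ?S"
    proof (rule parent_tree_linked)
      show "r \<in> ?S" using r by simp
      show "0 < i \<and> p i \<in> ?S" if "i \<in> ?S" "i \<noteq> r" for i
        using ri[of i] that p[of i] by auto
    qed (use p in auto)
    then show "connected (with_proj ?T \<restriction> ?S)"
      using connected_restrict_iff[OF parent_tree_sym] r by auto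
  qed
  then have "treewidth ?G \<le> decomposition_width ?T B"
    unfolding treewidth_def by (intro Least_le) blast
  moreover have "Max ((\<lambda>i. card (B i)) ` {..n}) \<le> Suc w"
    using B by (intro Max.boundedI) auto
  then have "decomposition_width ?T B \<le> w"
    unfolding decomposition_width_def parent_tree_simps by linarith
  ultimately show ?thesis by linarith
qed

section \<open>Partitions as labellings\<close>

lemma containsI:
  assumes G: "parcs G \<subseteq> pverts G \<times> pverts G" and H: "parcs H \<subseteq> pverts H \<times> pverts H"
    and g: "inj_on g (pverts H)" "g ` pverts H \<subseteq> pverts G"
    and arcs: "\<And>u v. u \<in> pverts H \<Longrightarrow> v \<in> pverts H \<Longrightarrow> (u, v) \<in> parcs H \<longleftrightarrow> (g u, g v) \<in> parcs G"
  shows "contains G H"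
proof -
  let ?S = "\<lparr>pverts = g ` pverts H, parcs = Restr (parcs G) (g ` pverts H)\<rparr>"
  let ?h = "\<lparr>iso_verts = g, iso_arcs = map_prod g g, iso_head = snd, iso_tail = fst\<rparr>"
  have wf: "wf_digraph (with_proj K)" if "parcs K \<subseteq> pverts K \<times> pverts K" for K :: "'c pair_pre_digraph"
    using that by unfold_locales auto
  have "induced_subgraph (with_proj ?S) (with_proj G)"
    unfolding induced_subgraph_def subgraph_def
    using g(2) wf[OF G] wf[of ?S] by auto
  moreover have "digraph_iso (with_proj H) (with_proj ?S)"
    unfolding digraph_iso_def
  proof (rule exI[of _ ?h], rule conjI)
    have "inj_on (map_prod g g) (parcs H)"
      using map_prod_inj_on[OF g(1) g(1)] H by (rule inj_on_subset)
    then show "pre_digraph.digraph_isomorphism (with_proj H) ?h"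
      unfolding pre_digraph.digraph_isomorphism_def using wf[OF H] g(1) by simp
    have "map_prod g g ` parcs H = Restr (parcs G) (g ` pverts H)"
    proof
      show "map_prod g g ` parcs H \<subseteq> Restr (parcs G) (g ` pverts H)"
      proof
        fix e assume "e \<in> map_prod g g ` parcs H"
        then obtain u v where "e = (g u, g v)" "(u, v) \<in> parcs H" by auto
        then show "e \<in> Restr (parcs G) (g ` pverts H)" using H arcs[of u v] by auto
      qed
      show "Restr (parcs G) (g ` pverts H) \<subseteq> map_prod g g ` parcs H"
      proof
        fix e assume "e \<in> Restr (parcs G) (g ` pverts H)"
        then obtain u v where uv: "u \<in> pverts H" "v \<in> pverts H" "e = (g u, g v)" "(g u, g v) \<in> parcs G"
          by auto
        then have "(u, v) \<in> parcs H" using arcs by blast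
        then show "e \<in> map_prod g g ` parcs H" using uv(3) by (metis image_eqI map_prod_simp)
      qed
    qed
    then show "with_proj ?S = app_iso ?h (with_proj H)"
      by (simp add: app_iso_def with_proj_def)
  qed
  ultimately show ?thesis unfolding contains_def by blast
qed

text \<open>
  A simple graph together with a chordal partition; its cells are the vertex sets of the parts.
\<close>

locale partitioned_graph =
  fixes V :: "'a set" and E :: "'a rel" and \<P> :: "'a pair_pre_digraph set"
  assumes E: "E \<subseteq> V \<times> V" "sym E" "irrefl E"
    and partition: "chordal_partition \<lparr>pverts = V, parcs = E\<rparr> \<P>"
begin

definition part :: "'a \<Rightarrow> 'a pair_pre_digraph" where
  "part v = (THE P. P \<in> \<P> \<and> v \<in> pverts P)"

definition cell :: "'a \<Rightarrow> 'a set" where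
  "cell v = pverts (part v)"

lemma ex1_part: "v \<in> V \<Longrightarrow> \<exists>!P. P \<in> \<P> \<and> v \<in> pverts P"
  using partition unfolding chordal_partition_def connected_partition_def graph_partition_def by simp

lemma part: "v \<in> V \<Longrightarrow> part v \<in> \<P> \<and> v \<in> pverts (part v)"
  unfolding part_def by (drule ex1_part) (rule theI')

lemma part_props:
  assumes "P \<in> \<P>"
  shows "pverts P \<subseteq> V" "parcs P = Restr E (pverts P)" "linked E (pverts P)"
proof -
  have ind: "induced_subgraph (with_proj P) (with_proj \<lparr>pverts = V, parcs = E\<rparr>)"
    and conn: "connected (with_proj P)"
    using partition assms
    unfolding chordal_partition_def connected_partition_def graph_partition_def by blast+
  show "pverts P \<subseteq> V" using ind unfolding induced_subgraph_def subgraph_def by simp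
  have "parcs P = {e \<in> E. fst e \<in> pverts P \<and> snd e \<in> pverts P}"
    using ind unfolding induced_subgraph_def by simp
  also have "\<dots> = Restr E (pverts P)" by auto
  finally show parcs: "parcs P = Restr E (pverts P)" .
  have "sym (parcs P)" using E(2) unfolding parcs by (auto simp: sym_def)
  then have "linked (parcs P) (pverts P)"
    using conn connected_with_proj_iff[of P] parcs by simp
  then show "linked E (pverts P)" by (rule linked_mono) (simp add: parcs)
qed

lemma part_eqI: "P \<in> \<P> \<Longrightarrow> v \<in> pverts P \<Longrightarrow> part v = P"
  unfolding part_def by (rule the1_equality[OF ex1_part]) (use part_props(1) in blast)+

lemma cell_eq_iff: "u \<in> V \<Longrightarrow> v \<in> V \<Longrightarrow> cell u = cell v \<longleftrightarrow> part u = part v"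
  unfolding cell_def using part[of u] part[of v] part_eqI[of "part v" u] by auto

lemma quotient_arc_iff:
  assumes "u \<in> V" "v \<in> V"
  shows "(part u, part v) \<in> parcs (quotient_graph \<lparr>pverts = V, parcs = E\<rparr> \<P>) \<longleftrightarrow>
    cell u \<noteq> cell v \<and> touching cell E (cell u) (cell v)"
proof -
  have "(\<exists>x\<in>pverts (part u). \<exists>y\<in>pverts (part v). (x, y) \<in> E) \<longleftrightarrow> touching cell E (cell u) (cell v)"
  proof
    assume "\<exists>x\<in>pverts (part u). \<exists>y\<in>pverts (part v). (x, y) \<in> E"
    then obtain x y where "x \<in> pverts (part u)" "y \<in> pverts (part v)" "(x, y) \<in> E" by blast
    moreover from this have "part x = part u" "part y = part v" using part part_eqI assms by blast+
    ultimately show "touching cell E (cell u) (cell v)"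
      unfolding touching_def cell_def by metis
  next
    assume "touching cell E (cell u) (cell v)"
    then obtain x y where xy: "(x, y) \<in> E" "cell x = cell u" "cell y = cell v"
      unfolding touching_def by metis
    then have "x \<in> cell u" "y \<in> cell v" using part[of x] part[of y] E(1) unfolding cell_def by blast+
    then show "\<exists>x\<in>pverts (part u). \<exists>y\<in>pverts (part v). (x, y) \<in> E"
      using xy(1) unfolding cell_def by blast
  qed
  then show ?thesis
    using part assms cell_eq_iff[OF assms] unfolding quotient_graph_def by simp
qed

lemma touching_sym:
  assumes "touching f E a b"
  shows "touching f E b a"
proof -
  obtain u v where "(u, v) \<in> E" "f u = a" "f v = b" using assms unfolding touching_def by metis
  then show ?thesis using touchingI[OF symD[OF E(2)], of u v f] by simp
qed

text \<open>
  An induced four-cycle of labels would be a copy of the cycle on four vertices in the quotient.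
\<close>

lemma connected_C4_free_cell: "connected_C4_free cell V E"
proof -
  have "(x, y) \<in> (inner_edges cell E)\<^sup>*" if xy: "x \<in> V" "y \<in> V" "cell x = cell y" for x y
  proof -
    let ?S = "pverts (part x)"
    have P: "part x \<in> \<P>" "x \<in> ?S" using part xy(1) by blast+
    have "y \<in> ?S" using part[OF xy(2)] xy(3) unfolding cell_def by simp
    then have "(x, y) \<in> (Restr E ?S)\<^sup>*" using linkedD[OF part_props(3)] P by blast
    moreover have "Restr E ?S \<subseteq> inner_edges cell E"
      using part_eqI[OF P(1)] unfolding inner_edges_def cell_def by auto
    ultimately show ?thesis using rtrancl_mono by blast
  qed
  moreover have "\<not> induced_C4 cell E a b c d" for a b c d
  proof
    assume C4: "induced_C4 cell E a b c d"
    note touch = C4[unfolded induced_C4_def]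
    have lab: "\<exists>x\<in>V. cell x = p" if "touching cell E p q" for p q
      using that E(1) unfolding touching_def by blast
    obtain xa xb xc xd where x: "xa \<in> V" "xb \<in> V" "xc \<in> V" "xd \<in> V"
      and abcd: "cell xa = a" "cell xb = b" "cell xc = c" "cell xd = d"
      using touch lab by metis
    let ?Q = "quotient_graph \<lparr>pverts = V, parcs = E\<rparr> \<P>"
    define g where "g i = part ([xa, xb, xc, xd] ! i)" for i
    have "contains ?Q (cycle_graph 4)"
    proof (rule containsI[of _ _ g])
      show "parcs ?Q \<subseteq> pverts ?Q \<times> pverts ?Q" unfolding quotient_graph_def by auto
      show "parcs (cycle_graph 4) \<subseteq> pverts (cycle_graph 4) \<times> pverts (cycle_graph 4)"
        unfolding cycle_graph_def by auto
      have V4: "pverts (cycle_graph 4) = {0, 1, 2, 3}" unfolding cycle_graph_def by auto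
      have g: "g 0 = part xa" "g (Suc 0) = part xb" "g 2 = part xc" "g 3 = part xd"
        by (simp_all add: g_def)
      have "distinct [cell xa, cell xb, cell xc, cell xd]" using touch abcd by simp
      then have "part xa \<noteq> part xb" "part xa \<noteq> part xc" "part xa \<noteq> part xd"
        "part xb \<noteq> part xc" "part xb \<noteq> part xd" "part xc \<noteq> part xd"
        unfolding cell_def by auto
      then show "inj_on g (pverts (cycle_graph 4))" by (simp add: V4 g)
      show "g ` pverts (cycle_graph 4) \<subseteq> pverts ?Q"
        using x part by (simp add: V4 g quotient_graph_def)
      have arcs4: "(i, j) \<in> parcs (cycle_graph 4) \<longleftrightarrow>
          (i, j) \<in> {(0,1),(1,2),(2,3),(3,0),(1,0),(2,1),(3,2),(0,3)}"
        if "i \<in> {0, 1, 2, 3}" "j \<in> {0, 1, 2, 3}" for i j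
        using that by (elim insertE emptyE) (simp_all add: cycle_graph_def)
      show "(i, j) \<in> parcs (cycle_graph 4) \<longleftrightarrow> (g i, g j) \<in> parcs ?Q"
        if "i \<in> pverts (cycle_graph 4)" "j \<in> pverts (cycle_graph 4)" for i j
      proof -
        have rev: "touching cell E b a" "touching cell E c b" "touching cell E d c" "touching cell E a d"
          "\<not> touching cell E c a" "\<not> touching cell E d b"
          using touch touching_sym[of cell a b] touching_sym[of cell b c] touching_sym[of cell c d]
            touching_sym[of cell d a] touching_sym[of cell c a] touching_sym[of cell d b] by blast+
        have "\<forall>i\<in>{0, 1, 2, 3}. \<forall>j\<in>{0, 1, 2, 3}. (g i, g j) \<in> parcs ?Q \<longleftrightarrow>
            (i, j) \<in> {(0,1),(1,2),(2,3),(3,0),(1,0),(2,1),(3,2),(0,3)}"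
          using touch by (simp add: g quotient_arc_iff x abcd rev) blast
        from bspec[OF bspec[OF this that(1)[unfolded V4]] that(2)[unfolded V4]]
        show ?thesis using arcs4[OF that[unfolded V4]] by (rule trans[OF _ sym, rotated])
      qed
    qed
    then show False
      using partition unfolding chordal_partition_def chordal_def by auto
  qed
  ultimately show ?thesis unfolding connected_C4_free_def by blast
qed

lemma has_mono_clique_contains:
  assumes "has_mono_clique k cell V E" "1 \<le> k"
  shows "\<exists>P\<in>\<P>. contains P (complete_graph k)"
proof -
  obtain D where D: "D \<subseteq> V" "card D = k" "clique E D" "monochromatic cell D"
    using assms(1) unfolding has_mono_clique_def by blast
  obtain x where x: "x \<in> D" using D(2) assms(2) by fastforce
  have xV: "x \<in> V" using x D(1) by blast
  define P where "P = part x"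
  have P: "P \<in> \<P>" "P = part x" using part[OF xV] by (simp_all add: P_def)
  have DP: "D \<subseteq> pverts P"
  proof
    fix y assume y: "y \<in> D"
    then have "cell y = cell x" using monochromaticD[OF D(4)] x by blast
    then show "y \<in> pverts P" using part[of y] y D(1) unfolding P(2) cell_def by auto
  qed
  have "finite D" using D(2) assms(2) by (metis card.infinite not_one_le_zero)
  then obtain g where "bij_betw g {..<k} D"
    using ex_bij_betw_nat_finite[of D] D(2) by (auto simp: atLeast0LessThan)
  then have g: "inj_on g {..<k}" "g ` {..<k} = D" by (auto simp: bij_betw_def)
  have "contains P (complete_graph k)"
  proof (rule containsI[of _ _ g])
    show "parcs P \<subseteq> pverts P \<times> pverts P" using part_props(2)[OF P(1)] by blast
    show "parcs (complete_graph k) \<subseteq> pverts (complete_graph k) \<times> pverts (complete_graph k)"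
      unfolding complete_graph_def by auto
    show "inj_on g (pverts (complete_graph k))" using g(1) by (simp add: complete_graph_def)
    show "g ` pverts (complete_graph k) \<subseteq> pverts P"
      using g(2) DP by (simp add: complete_graph_def)
    show "(i, j) \<in> parcs (complete_graph k) \<longleftrightarrow> (g i, g j) \<in> parcs P"
      if ij: "i \<in> pverts (complete_graph k)" "j \<in> pverts (complete_graph k)" for i j
    proof -
      have lt: "i \<in> {..<k}" "j \<in> {..<k}" using ij by (simp_all add: complete_graph_def)
      then have gD: "g i \<in> D" "g j \<in> D" using g(2) by blast+
      have "(g i, g j) \<in> parcs P \<longleftrightarrow> g i \<noteq> g j"
        using gD DP cliqueD[OF D(3) gD] E(3) unfolding part_props(2)[OF P(1)] irrefl_def by auto
      also have "\<dots> \<longleftrightarrow> i \<noteq> j" using inj_on_eq_iff[OF g(1)] lt by blast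
      finally show ?thesis using lt by (auto simp: complete_graph_def)
    qed
  qed
  then show ?thesis using P(1) by blast
qed

end

section \<open>Large cliques in parts of chordal partitions\<close>

text \<open>
  The assumption on \<open>w\<close> is the recursive bound for the construction, in closed form.
\<close>

lemma forcing_graph:
  assumes k: "1 \<le> k" and w: "2 * int k ^ 3 - 3 * int k ^ 2 + int k + 18 \<le> 6 * int w"
  obtains G :: "nat pair_pre_digraph" where "pair_graph G" "treewidth G \<le> w"
    "\<And>n. Suc w < n \<Longrightarrow> \<not> has_minor G (complete_graph n)"
    "\<And>\<P>. chordal_partition G \<P> \<Longrightarrow> \<exists>P\<in>\<P>. contains P (complete_graph k)"
proof -
  have "unavoidable w (has_mono_clique k)" using k w by (rule unavoidable_has_mono_clique)
  then obtain V E where b: "partial_tree w V E"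
    and forced: "\<forall>f :: nat \<Rightarrow> nat set. connected_C4_free f V E \<longrightarrow> has_mono_clique k f V E"
    unfolding unavoidable_def by (elim allE[of _ "{}"] impE exE conjE) simp_all
  have E: "E \<subseteq> V \<times> V" "sym E" "irrefl E" and fin: "finite V"
    using b clique_built_finite unfolding partial_tree_def by blast+
  let ?G = "\<lparr>pverts = V, parcs = E\<rparr>"
  show thesis
  proof (rule that[of ?G])
    show "pair_graph ?G"
    proof
      show "finite (pverts ?G)" "finite (parcs ?G)"
        using fin E(1) by (auto intro: finite_subset)
      show "symmetric (with_proj ?G)" using E(2) by (simp add: symmetric_def)
      show "fst e \<noteq> snd e" if "e \<in> parcs ?G" for e
        using that E(3) by (cases e) (auto simp: irrefl_def)
    qed (use E(1) in auto)
    show "treewidth ?G \<le> w" using b by (rule partial_tree_treewidth)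
    show "\<not> has_minor ?G (complete_graph n)" if "Suc w < n" for n
      using b that by (rule partial_tree_no_minor)
    show "\<exists>P\<in>\<P>. contains P (complete_graph k)" if "chordal_partition ?G \<P>" for \<P>
    proof -
      interpret partitioned_graph V E \<P>
        using E that by unfold_locales
      show ?thesis using has_mono_clique_contains connected_C4_free_cell forced k by blast
    qed
  qed
qed

theorem theorem2:
  shows "(\<forall>k\<ge>1. \<exists>G :: nat pair_pre_digraph. pair_graph G \<and>
            (\<forall>\<P>. chordal_partition G \<P> \<longrightarrow> (\<exists>P\<in>\<P>. contains P (complete_graph k)))) \<and>
         (\<forall>t\<ge>(4::nat). \<exists>G :: nat pair_pre_digraph. pair_graph G \<and>
            treewidth G \<le> t - 1 \<and>
            \<not> has_minor G (complete_graph (t + 1)) \<and>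
            (\<forall>\<P>. chordal_partition G \<P> \<longrightarrow>
               (\<exists>P\<in>\<P>. \<exists>n. int n \<ge> \<lfloor>root 3 (3 * real t - 11)\<rfloor> \<and>
                  contains P (complete_graph n))))"
proof (intro conjI allI impI)
  fix k :: nat assume k: "1 \<le> k"
  have "int k \<le> int k ^ 3" using k by (simp add: self_le_power del: of_nat_power)
  then have "2 * int k ^ 3 - 3 * int k ^ 2 + int k + 18 \<le> 6 * int k ^ 3 + 108"
    using zero_le_power2[of "int k"] by linarith
  then have "2 * int k ^ 3 - 3 * int k ^ 2 + int k + 18 \<le> 6 * int (k ^ 3 + 18)" by simp
  then show "\<exists>G :: nat pair_pre_digraph. pair_graph G \<and>
      (\<forall>\<P>. chordal_partition G \<P> \<longrightarrow> (\<exists>P\<in>\<P>. contains P (complete_graph k)))"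
    using forcing_graph[OF k] by metis
next
  fix t :: nat assume t: "4 \<le> t"
  let ?r = "root 3 (3 * real t - 11)"
  define k where "k = nat \<lfloor>?r\<rfloor>"
  have "root 3 1 \<le> ?r" using t by (intro real_root_le_mono) auto
  then have r1: "1 \<le> ?r" by simp
  then have k: "1 \<le> k" "int k = \<lfloor>?r\<rfloor>" unfolding k_def by linarith+
  have "real k \<le> ?r" using k(2) by linarith
  then have "real k ^ 3 \<le> ?r ^ 3" by (intro power_mono) auto
  also have "?r ^ 3 = 3 * real t - 11" using t by (intro real_root_pow_pos2) auto
  finally have "real (k ^ 3 + 11) \<le> real (3 * t)" by simp
  then have "int (k ^ 3 + 11) \<le> int (3 * t)" by linarith
  then have cube: "int k ^ 3 + 11 \<le> 3 * int t" by simp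
  have "int k \<le> int k ^ 2" "1 \<le> int k ^ 2"
    using k(1) by (simp_all add: self_le_power del: of_nat_power)
  moreover have "6 * int (t - 1) = 6 * int t - 6" using t by (simp add: of_nat_diff)
  ultimately have w: "2 * int k ^ 3 - 3 * int k ^ 2 + int k + 18 \<le> 6 * int (t - 1)"
    using cube by linarith
  show "\<exists>G :: nat pair_pre_digraph. pair_graph G \<and>
            treewidth G \<le> t - 1 \<and>
            \<not> has_minor G (complete_graph (t + 1)) \<and>
            (\<forall>\<P>. chordal_partition G \<P> \<longrightarrow>
               (\<exists>P\<in>\<P>. \<exists>n. int n \<ge> \<lfloor>root 3 (3 * real t - 11)\<rfloor> \<and>
                  contains P (complete_graph n)))"
  proof (rule forcing_graph[OF k(1) w])
    fix G :: "nat pair_pre_digraph"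
    assume G: "pair_graph G" "treewidth G \<le> t - 1"
      "\<And>n. Suc (t - 1) < n \<Longrightarrow> \<not> has_minor G (complete_graph n)"
      "\<And>\<P>. chordal_partition G \<P> \<Longrightarrow> \<exists>P\<in>\<P>. contains P (complete_graph k)"
    have "\<not> has_minor G (complete_graph (t + 1))" using G(3) t by simp
    moreover have "\<exists>P\<in>\<P>. \<exists>n. int n \<ge> \<lfloor>?r\<rfloor> \<and> contains P (complete_graph n)"
      if "chordal_partition G \<P>" for \<P>
      using G(4)[OF that] k(2) by (metis order_refl)
    ultimately show ?thesis using G(1,2) by blast
  qed
qed

end
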